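(* Let $X$ be a real Banach space and let $A\colon X\rightrightarrows X^*$ be a monotone linear relation such that $\operatorname{gra}A$ is closed and $\operatorname{dom}A$ is closed. Then the following are equivalent: (i) $A$ is maximally monotone of type (D). (ii) $A$ is maximally monotone of type (NI). (iii) $A$ is maximally monotone of type (FP). (iv) $A^*$ is monotone. (v) $A^*$ is maximally monotone with respect to $X^{**}\times X^*$. (vi) $A_{\circ}$ is maximally monotone of type (D) and $A^*0=A0$. (vii) $(A_{\circ})^*$ is maximally monotone with respect to $X^{**}\times X^*$ and $A^*0=A0$. (viii) $(A_{\circ})^*$ is monotone and $A^*0=A0$.
   Context: $X$ is identified with its canonical image in $X^{**}$. For a set-valued operator $A\colon X\rightrightarrows X^*$, $\operatorname{gra}A=\{(x,x^* )\in X\times X^*\mid x^*\in Ax\}$, $\operatorname{dom}A=\{x\in X\mid Ax\neq\varnothing\}$, $\operatorname{ran}A=\bigcup_{x\in X}Ax$. $A$ is a linear relation if $\operatorname{gra}A$ is a linear subspace. "Closed" means norm closed. For $U\times V\subseteq X\times X^*$, $A$ is monotone with respect to $U\times V$ if $\langle x-y,x^*-y^*\rangle\ge 0$ for all $(x,x^* ),(y,y^* )\in(\operatorname{gra}A)\cap(U\times V)$. $A$ is maximally monotone with respect to $U\times V$ if it is monotone with respect to $U\times V$ and for every $B\colon X\rightrightarrows X^*$ monotone with respect to $U\times V$ with $(\operatorname{gra}A)\cap(U\times V)\subseteq(\operatorname{gra}B)\cap(U\times V)$ one has equality of these two sets. (Maximally) monotone without qualification means with respect to $X\times X^*$. The adjoint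 $A^*$ of a linear relation $A$ is given by $\operatorname{gra}A^*=\{(x^{**},x^* )\in X^{**}\times X^*\mid \langle a,x^*\rangle=\langle a^*,x^{**}\rangle\ \forall (a,a^* )\in\operatorname{gra}A\}$. $A^*$ is monotone if $\langle x^{**}-y^{**},x^*-y^*\rangle\ge0$ for all $(x^{**},x^* ),(y^{**},y^* )\in\operatorname{gra}A^*$; it is maximally monotone with respect to $X^{**}\times X^*$ if it is monotone and its graph is not properly contained in any monotone subset of $X^{**}\times X^*$. The same applies to $(A_\circ)^*$. The skew part of $A$ is the linear relation $A_\circ=\tfrac12A-\tfrac12A^*\colon X\rightrightarrows X^*$, i.e. $A_\circ x=\{\tfrac12x^*-\tfrac12y^*\mid x^*\in Ax,\ y^*\in A^*x\}$ for $x\in X$ (so $\operatorname{dom}A_\circ=\operatorname{dom}A\cap\operatorname{dom}A^*$). A maximally monotone $A\colon X\rightrightarrows X^*$ is: - of type (D) if for every $(x^{**},x^* )\in X^{**}\times X^*$ with $\inf_{(a,a^* )\in\operatorname{gra}A}\langle a-x^{**},a^*-x^*\rangle\ge0$ there is a bounded net $(a_\alpha,a^*_\alpha)$ in $\operatorname{gra}A$ with $a_\alpha\to x^{**}$ in $\sigma(X^{**},X^* )$ and $a_\alpha^*\to x^*$ in norm; - of type (NI) if $\sup_{(a,a^* )\in\operatorname{gra}A}\big(\langle a,x^*\rangle+\langle a^*,x^{**}\rangle-\langle a,a^*\rangle\big)\ge\langle x^{**},x^*\rangle$ for all $(x^{**},x^* )\in X^{**}\times X^*$; - of type (FP) if for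 every open convex $V\subseteq X^*$ with $V\cap\operatorname{ran}A\ne\varnothing$, $A$ is maximally monotone with respect to $X\times V$. *)

theory Defs
  imports "HOL-Analysis.Analysis"
begin

type_synonym 'a dual = "'a \<Rightarrow>\<^sub>L real"
type_synonym 'a bidual = "('a \<Rightarrow>\<^sub>L real) \<Rightarrow>\<^sub>L real"

text \<open>The canonical embedding of a space into its bidual. It is written out wherever the
  mathematical text identifies a space with its image.\<close>

lift_definition canon :: "'a::real_normed_vector \<Rightarrow> 'a bidual" is "\<lambda>x f. blinfun_apply f x"
  by (rule blinfun.bounded_linear_left)

section \<open>Set-valued operators and monotonicity\<close>

definition gra :: "('a \<Rightarrow> 'b set) \<Rightarrow> ('a \<times> 'b) set" where
  "gra A = {(x, y). y \<in> A x}"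

definition dom :: "('a \<Rightarrow> 'b set) \<Rightarrow> 'a set" where
  "dom A = {x. A x \<noteq> {}}"

definition ran :: "('a \<Rightarrow> 'b set) \<Rightarrow> 'b set" where
  "ran A = (\<Union>x. A x)"

definition linear_relation :: "('a::real_vector \<Rightarrow> 'b::real_vector set) \<Rightarrow> bool" where
  "linear_relation A \<longleftrightarrow> subspace (gra A)"

definition monotone_wrt ::
  "('a::real_normed_vector \<Rightarrow> 'a dual set) \<Rightarrow> 'a set \<Rightarrow> 'a dual set \<Rightarrow> bool" where
  "monotone_wrt A U V \<longleftrightarrow>
    (\<forall>(x, x') \<in> gra A \<inter> (U \<times> V). \<forall>(y, y') \<in> gra A \<inter> (U \<times> V).
      blinfun_apply (x' - y') (x - y) \<ge> 0)"

definition maximally_monotone_wrt ::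
  "('a::real_normed_vector \<Rightarrow> 'a dual set) \<Rightarrow> 'a set \<Rightarrow> 'a dual set \<Rightarrow> bool" where
  "maximally_monotone_wrt A U V \<longleftrightarrow>
    monotone_wrt A U V \<and>
    (\<forall>B. monotone_wrt B U V \<and> gra A \<inter> (U \<times> V) \<subseteq> gra B \<inter> (U \<times> V)
      \<longrightarrow> gra A \<inter> (U \<times> V) = gra B \<inter> (U \<times> V))"

abbreviation monotone_op :: "('a::real_normed_vector \<Rightarrow> 'a dual set) \<Rightarrow> bool" where
  "monotone_op A \<equiv> monotone_wrt A UNIV UNIV"

abbreviation maximally_monotone :: "('a::real_normed_vector \<Rightarrow> 'a dual set) \<Rightarrow> bool" where
  "maximally_monotone A \<equiv> maximally_monotone_wrt A UNIV UNIV"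

section \<open>Monotonicity in the product of bidual and dual\<close>

definition bidual_monotone_set :: "('a::real_normed_vector bidual \<times> 'a dual) set \<Rightarrow> bool" where
  "bidual_monotone_set S \<longleftrightarrow>
    (\<forall>(x'', x') \<in> S. \<forall>(y'', y') \<in> S. blinfun_apply (x'' - y'') (x' - y') \<ge> 0)"

definition bidual_monotone :: "('a::real_normed_vector bidual \<Rightarrow> 'a dual set) \<Rightarrow> bool" where
  "bidual_monotone C \<longleftrightarrow> bidual_monotone_set (gra C)"

definition bidual_maximally_monotone ::
  "('a::real_normed_vector bidual \<Rightarrow> 'a dual set) \<Rightarrow> bool" where
  "bidual_maximally_monotone C \<longleftrightarrow>
    bidual_monotone C \<and> \<not> (\<exists>S. bidual_monotone_set S \<and> gra C \<subset> S)"

section \<open>Adjoint and skew part\<close>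

definition adjoint_rel ::
  "('a::real_normed_vector \<Rightarrow> 'a dual set) \<Rightarrow> 'a bidual \<Rightarrow> 'a dual set" where
  "adjoint_rel A x'' =
    {x'. \<forall>(a, a') \<in> gra A. blinfun_apply x' a = blinfun_apply x'' a'}"

definition skew_part ::
  "('a::real_normed_vector \<Rightarrow> 'a dual set) \<Rightarrow> 'a \<Rightarrow> 'a dual set" where
  "skew_part A x =
    {(1/2) *\<^sub>R x' - (1/2) *\<^sub>R y' |x' y'. x' \<in> A x \<and> y' \<in> adjoint_rel A (canon x)}"

section \<open>Nets\<close>

definition directed_set :: "'i set \<Rightarrow> ('i \<Rightarrow> 'i \<Rightarrow> bool) \<Rightarrow> bool" where
  "directed_set I le \<longleftrightarrow>
    I \<noteq> {} \<and> (\<forall>i\<in>I. le i i) \<and>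
    (\<forall>i\<in>I. \<forall>j\<in>I. \<forall>k\<in>I. le i j \<longrightarrow> le j k \<longrightarrow> le i k) \<and>
    (\<forall>i\<in>I. \<forall>j\<in>I. \<exists>k\<in>I. le i k \<and> le j k)"

definition tails :: "'i set \<Rightarrow> ('i \<Rightarrow> 'i \<Rightarrow> bool) \<Rightarrow> 'i filter" where
  "tails I le = (INF i\<in>I. principal {j\<in>I. le i j})"

lemma eventually_tails:
  assumes "directed_set I le"
  shows "eventually P (tails I le) \<longleftrightarrow> (\<exists>i\<in>I. \<forall>j\<in>I. le i j \<longrightarrow> P j)"
proof -
  have "eventually P (tails I le) \<longleftrightarrow> (\<exists>i\<in>I. eventually P (principal {j\<in>I. le i j}))"
    unfolding tails_def
  proof (rule eventually_INF_base)
    show "I \<noteq> {}" using assms by (simp add: directed_set_def)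
    fix i j assume ij: "i \<in> I" "j \<in> I"
    obtain k where k: "k \<in> I" "le i k" "le j k"
      using assms ij unfolding directed_set_def by blast
    have "{l\<in>I. le k l} \<subseteq> {l\<in>I. le i l} \<inter> {l\<in>I. le j l}"
      using assms ij k unfolding directed_set_def by blast
    then show "\<exists>k\<in>I. principal {l\<in>I. le k l} \<le>
        inf (principal {l\<in>I. le i l}) (principal {l\<in>I. le j l})"
      using k(1) by (intro bexI[of _ k]) simp_all
  qed
  then show ?thesis by (auto simp: eventually_principal)
qed

text \<open>Existential quantification over nets needs a fixed index type. The next two lemmas show
  that for nets in a type \<open>'b\<close> the index type \<open>'b \<times> 'b set\<close> loses no generality: the tails of
  a net with any index type form a proper filter, and every proper filter arises from a net of
  this index type.\<close>

lemma net_imp_filter: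
  fixes u :: "'i \<Rightarrow> 'b"
  assumes "directed_set I le" "u ` I \<subseteq> S"
  shows "filtermap u (tails I le) \<noteq> bot" "filtermap u (tails I le) \<le> principal S"
proof -
  have "\<not> eventually (\<lambda>_. False) (tails I le)"
    unfolding eventually_tails[OF assms(1)] using assms(1) unfolding directed_set_def by blast
  then show "filtermap u (tails I le) \<noteq> bot"
    by (simp add: trivial_limit_def eventually_filtermap)
  have "eventually (\<lambda>i. u i \<in> S) (tails I le)"
    unfolding eventually_tails[OF assms(1)] using assms unfolding directed_set_def by blast
  then show "filtermap u (tails I le) \<le> principal S"
    by (simp add: le_principal eventually_filtermap)
qed

lemma filter_imp_net:
  fixes F :: "'b filter"
  assumes "F \<noteq> bot" "F \<le> principal S"
  obtains I :: "('b \<times> 'b set) set" and le u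
  where "directed_set I le" "u ` I \<subseteq> S" "filtermap u (tails I le) = F"
proof -
  define I where "I = {(p, Q). p \<in> Q \<and> Q \<subseteq> S \<and> eventually (\<lambda>x. x \<in> Q) F}"
  define le :: "'b \<times> 'b set \<Rightarrow> 'b \<times> 'b set \<Rightarrow> bool" where "le = (\<lambda>i j. snd j \<subseteq> snd i)"
  have ne: "\<exists>p. p \<in> Q" if "eventually (\<lambda>x. x \<in> Q) F" for Q
    using eventually_happens[OF that] assms(1) by auto
  have S: "eventually (\<lambda>x. x \<in> S) F" using assms(2) by (simp add: le_principal)
  have dir: "directed_set I le"
    unfolding directed_set_def
  proof (intro conjI ballI)
    show "I \<noteq> {}" using ne[OF S] S by (auto simp: I_def)
    fix i j assume ij: "i \<in> I" "j \<in> I"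
    have ev: "eventually (\<lambda>x. x \<in> snd i \<inter> snd j) F"
      using ij by (auto simp: I_def eventually_conj_iff)
    obtain p where "p \<in> snd i \<inter> snd j" using ne[OF ev] by blast
    then have "(p, snd i \<inter> snd j) \<in> I" using ij ev by (auto simp: I_def)
    then show "\<exists>k\<in>I. le i k \<and> le j k"
      by (intro bexI[of _ "(p, snd i \<inter> snd j)"]) (simp_all add: le_def)
  qed (auto simp: le_def)
  have "eventually P (filtermap fst (tails I le)) \<longleftrightarrow> eventually P F" for P
  proof
    assume "eventually P (filtermap fst (tails I le))"
    then obtain i where i: "i \<in> I" "\<And>j. j \<in> I \<Longrightarrow> le i j \<Longrightarrow> P (fst j)"
      using dir by (auto simp: eventually_filtermap eventually_tails)
    have "P x" if "x \<in> snd i" for x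
      using i(1) i(2)[of "(x, snd i)"] that by (auto simp: I_def le_def)
    then show "eventually P F"
      using i(1) by (auto simp: I_def elim: eventually_mono)
  next
    assume "eventually P F"
    then have ev: "eventually (\<lambda>x. x \<in> {x \<in> S. P x}) F"
      using S by (simp add: eventually_conj_iff)
    obtain p where "p \<in> {x \<in> S. P x}" using ne[OF ev] by blast
    then have "(p, {x \<in> S. P x}) \<in> I" using ev by (auto simp: I_def)
    moreover have "P (fst j)" if "j \<in> I" "le (p, {x \<in> S. P x}) j" for j
      using that by (auto simp: I_def le_def)
    ultimately show "eventually P (filtermap fst (tails I le))"
      using dir unfolding eventually_filtermap by (subst eventually_tails) blast+
  qed
  then have "filtermap fst (tails I le) = F" by (simp add: filter_eq_iff)
  moreover have "fst ` I \<subseteq> S" by (auto simp: I_def)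
  ultimately show thesis using dir that by blast
qed

section \<open>Types (D), (NI) and (FP)\<close>

text \<open>The strong operator topology on functionals is the topology of pointwise convergence;
  on the bidual this is \<open>\<sigma>(X**, X*)\<close>. Infima and suprema are taken in the extended reals.\<close>

abbreviation weak_star_topology :: "('a::real_normed_vector \<Rightarrow>\<^sub>L real) topology" where
  "weak_star_topology \<equiv> strong_operator_topology"

definition type_D :: "('a::real_normed_vector \<Rightarrow> 'a dual set) \<Rightarrow> bool" where
  "type_D A \<longleftrightarrow>
    (\<forall>x'' x'.
      (INF (a, a') \<in> gra A. ereal (blinfun_apply (canon a - x'') (a' - x'))) \<ge> 0 \<longrightarrow>
      (\<exists>(I :: (('a \<times> 'a dual) \<times> ('a \<times> 'a dual) set) set) le a a'.
        directed_set I le \<and>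
        (\<forall>i\<in>I. (a i, a' i) \<in> gra A) \<and>
        bounded ((\<lambda>i. (a i, a' i)) ` I) \<and>
        limitin weak_star_topology (\<lambda>i. canon (a i)) x'' (tails I le) \<and>
        (a' \<longlongrightarrow> x') (tails I le)))"

definition type_NI :: "('a::real_normed_vector \<Rightarrow> 'a dual set) \<Rightarrow> bool" where
  "type_NI A \<longleftrightarrow>
    (\<forall>x'' x'.
      (SUP (a, a') \<in> gra A.
        ereal (blinfun_apply x' a + blinfun_apply x'' a' - blinfun_apply a' a))
      \<ge> ereal (blinfun_apply x'' x'))"

definition type_FP :: "('a::real_normed_vector \<Rightarrow> 'a dual set) \<Rightarrow> bool" where
  "type_FP A \<longleftrightarrow>
    (\<forall>V. open V \<and> convex V \<and> V \<inter> ran A \<noteq> {} \<longrightarrow> maximally_monotone_wrt A UNIV V)"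

end

theory Submission
  imports Defs
begin

text \<open>Let \<open>D\<close> be the domain of \<open>A\<close> and call \<open>a' a\<close>, for \<open>(a, a')\<close> in the graph, the energy; it is a
positive semidefinite quadratic form on the graph. All eight conditions are compared with the
monotonicity of the adjoint \<open>A*\<close>.

Since graph and domain are closed, the closed graph theorem provides a constant \<open>C\<close> such that every
\<open>a \<in> D\<close> has an image \<open>a'\<close> with \<open>norm a' \<le> C * norm a\<close> (\<open>closed_relation_bounded\<close>). Two things
follow. The domain of \<open>A*\<close> is the whole annihilator of \<open>A 0\<close> in the bidual (\<open>adjoint_domain\<close>), and the
energy is bounded by \<open>C * (norm a)\<^sup>2\<close>. From the first one, monotonicity of \<open>A*\<close> forces \<open>A 0\<close> to be the
annihilator of \<open>D\<close>, which is \<open>A* 0\<close> and which for closed \<open>D\<close> means that \<open>A\<close> is maximally monotone.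

Types (NI) and (FP) imply that \<open>A*\<close> is monotone by a test at a single point. For \<open>(z, z')\<close> in the graph
of \<open>A*\<close>, type (NI) at \<open>(-z, z')\<close> reads \<open>0 \<le> z z'\<close>. If \<open>z z' < 0\<close>, type (FP) fails at \<open>(0, z')\<close> for the
half space where \<open>z\<close> is negative. Type (D) implies type (NI), because along a bounded net
whose second component converges to \<open>x'\<close> in norm the pairing of the differences to \<open>(x'', x')\<close> tends
to zero.

Conversely let \<open>A*\<close> be monotone and let \<open>(x'', x')\<close> be monotonically related to the graph. Then the
linear functional \<open>L (a, a') = (x' a + x'' a') / 2\<close> satisfies \<open>L\<^sup>2 \<le> x'' x' * energy\<close>. By an approximate
Riesz representation it is, up to a functional \<open>e\<close> of small norm, the energy product with some
\<open>(b, b')\<close> in the graph. This says that \<open>(x'' - b, b' - x' + 2 e)\<close> lies in the graph of \<open>A*\<close>, and its energy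
there is at most of the order of the error. The Cauchy--Schwarz inequality for the energy of \<open>A*\<close> then gives
\<open>x'' w' = w x'\<close> for every \<open>(w, w')\<close> in the graph of \<open>A*\<close> (\<open>related_imp_adjoint_symmetric\<close>). So
\<open>(x'', x')\<close> belongs to the second adjoint of \<open>A\<close>, and a Goldstine argument with the Hahn--Banach theorem
approximates it by a bounded net in the graph: this is type (D). Type (FP) follows from type (NI) by a
separation argument (\<open>type_NI_imp_near_solution\<close>) and the convexity of the energy.

For the skew part suppose \<open>A 0 = A* 0\<close>. Then \<open>A*\<close> and the adjoint of the skew part have the same domain, and
at a point \<open>z\<close> their values \<open>z'\<close>, \<open>y'\<close> differ by the value of the symmetric part. Two estimates from the same
Riesz representation, \<open>z y' \<le> z z'\<close> and, for monotone \<open>A*\<close>, \<open>0 \<le> z y'\<close>, show that one adjoint is monotone if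
and only if the other one is (\<open>adjoint_skew_part_split\<close>). The skew part satisfies the hypotheses of the
theorem as well, so the first part of the proof applies to it.\<close>

section \<open>The Hahn--Banach theorem for convex epigraphs\<close>

text \<open>The set \<open>S\<close> plays the part of the epigraph of a convex function and \<open>\<Gamma>\<close> that of the graph of a linear
functional below it. The admissible values \<open>c\<close> at a new vector \<open>x0\<close> are bounded below by the slopes
towards \<open>- x0\<close> and above by the slopes towards \<open>x0\<close>; convexity puts every lower slope below every
upper one.\<close>

lemma extension_constant_exists:
  fixes \<Gamma> :: "('e::real_vector \<times> real) set"
  assumes \<Gamma>: "subspace \<Gamma>"
    and conv: "convex S"
    and abs: "\<And>x. \<exists>t>0. \<exists>s. (t *\<^sub>R x, s) \<in> S"
    and le: "\<And>x r s. (x, r) \<in> \<Gamma> \<Longrightarrow> (x, s) \<in> S \<Longrightarrow> r \<le> s"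
  shows "\<exists>c. \<forall>y r t s. (y, r) \<in> \<Gamma> \<longrightarrow> (y + t *\<^sub>R x0, s) \<in> S \<longrightarrow> r + t * c \<le> s"
proof -
  define lower where "lower = {(r - s) / t | y r t s. (y, r) \<in> \<Gamma> \<and> t > 0 \<and> (y - t *\<^sub>R x0, s) \<in> S}"
  define upper where "upper = {(s - r) / t | y r t s. (y, r) \<in> \<Gamma> \<and> t > 0 \<and> (y + t *\<^sub>R x0, s) \<in> S}"
  have zero: "(0, 0) \<in> \<Gamma>" using subspace_0[OF \<Gamma>] by (simp add: zero_prod_def)
  have low_le_up: "l \<le> u" if "l \<in> lower" "u \<in> upper" for l u
  proof -
    obtain y r t s where l: "l = (r - s) / t" "(y, r) \<in> \<Gamma>" "t > 0" "(y - t *\<^sub>R x0, s) \<in> S"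
      using \<open>l \<in> lower\<close> unfolding lower_def by blast
    obtain z r' t' s' where u: "u = (s' - r') / t'" "(z, r') \<in> \<Gamma>" "t' > 0" "(z + t' *\<^sub>R x0, s') \<in> S"
      using \<open>u \<in> upper\<close> unfolding upper_def by blast
    \<comment> \<open>These weights cancel the multiples of \<open>x0\<close> in the convex combination.\<close>
    define \<alpha> where "\<alpha> = t' / (t + t')"
    define \<beta> where "\<beta> = t / (t + t')"
    have \<alpha>\<beta>: "\<alpha> \<ge> 0" "\<beta> \<ge> 0" "\<alpha> + \<beta> = 1" "\<alpha> * t = \<beta> * t'"
      using l(3) u(3) by (auto simp: \<alpha>_def \<beta>_def add_divide_distrib[symmetric])
    have "\<alpha> *\<^sub>R (y - t *\<^sub>R x0, s) + \<beta> *\<^sub>R (z + t' *\<^sub>R x0, s') \<in> S"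
      using convexD[OF conv l(4) u(4) \<alpha>\<beta>(1-3)] .
    then have S: "(\<alpha> *\<^sub>R y + \<beta> *\<^sub>R z, \<alpha> * s + \<beta> * s') \<in> S"
      using \<alpha>\<beta>(4) by (simp add: scaleR_right_distrib scaleR_right_diff_distrib)
    have "\<alpha> *\<^sub>R (y, r) + \<beta> *\<^sub>R (z, r') \<in> \<Gamma>"
      using \<Gamma> l(2) u(2) by (intro subspace_add subspace_scale)
    then have "\<alpha> * r + \<beta> * r' \<le> \<alpha> * s + \<beta> * s'" using le S by simp
    then have "(t' * r + t * r') / (t + t') \<le> (t' * s + t * s') / (t + t')"
      by (simp add: \<alpha>_def \<beta>_def add_divide_distrib)
    then have "t' * r + t * r' \<le> t' * s + t * s'"
      using l(3) u(3) by (simp add: divide_le_cancel)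
    then show ?thesis unfolding l(1) u(1) using l(3) u(3) by (simp add: field_simps)
  qed
  obtain t s where "t > 0" "(t *\<^sub>R x0, s) \<in> S" using abs by blast
  then have "(s - 0) / t \<in> upper" unfolding upper_def using zero by fastforce
  then have upper_ne: "upper \<noteq> {}" by blast
  obtain t s where "t > 0" "(t *\<^sub>R (- x0), s) \<in> S" using abs by blast
  then have "(0 - s) / t \<in> lower" unfolding lower_def using zero by fastforce
  then have lower_ne: "lower \<noteq> {}" by blast
  obtain u where "u \<in> upper" using upper_ne by blast
  then have bdd: "bdd_above lower" using low_le_up by (intro bdd_aboveI)
  define c where "c = Sup lower"
  have "r + t * c \<le> s" if "(y, r) \<in> \<Gamma>" "(y + t *\<^sub>R x0, s) \<in> S" for y r t s
  proof (cases "t = 0" "t > 0" rule: bool.exhaust[case_product bool.exhaust])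
    case True_True then show ?thesis by simp
  next
    case True_False then show ?thesis using le that by simp
  next
    case False_True
    then have "(s - r) / t \<in> upper" using that unfolding upper_def by blast
    then have "c \<le> (s - r) / t" unfolding c_def using lower_ne low_le_up by (intro cSup_least) auto
    then show ?thesis using False_True by (simp add: field_simps)
  next
    case False_False
    then have "(y - (- t) *\<^sub>R x0, s) \<in> S" "- t > 0" using that by auto
    then have "(r - s) / (- t) \<in> lower" using that unfolding lower_def by blast
    then have "(r - s) / (- t) \<le> c" unfolding c_def using bdd by (intro cSup_upper)
    then show ?thesis using False_False by (simp add: field_simps)
  qed
  then show ?thesis by blast
qed

text \<open>Working with an epigraph instead of a function has the advantage that functions given as an infimum,
such as an infimal convolution, need no computation of the infimum, nor a proof that it is finite. It is
enough that the epigraph lies over an absorbing set. Zorn's lemma is applied to the subspaces of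
\<open>E \<times> \<real>\<close> that extend \<open>\<Gamma>\<close> and lie below \<open>S\<close>.\<close>

theorem hahn_banach_epigraph:
  fixes S \<Gamma> :: "('e::real_vector \<times> real) set"
  assumes \<Gamma>: "subspace \<Gamma>"
    and conv: "convex S"
    and abs: "\<And>x. \<exists>t>0. \<exists>s. (t *\<^sub>R x, s) \<in> S"
    and le: "\<And>x r s. (x, r) \<in> \<Gamma> \<Longrightarrow> (x, s) \<in> S \<Longrightarrow> r \<le> s"
  obtains L where "linear L" "\<And>x r. (x, r) \<in> \<Gamma> \<Longrightarrow> L x = r" "\<And>x s. (x, s) \<in> S \<Longrightarrow> L x \<le> s"
proof -
  define F where "F = {G. subspace G \<and> \<Gamma> \<subseteq> G \<and> (\<forall>x r s. (x, r) \<in> G \<longrightarrow> (x, s) \<in> S \<longrightarrow> r \<le> s)}"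
  have "\<Gamma> \<in> F" using \<Gamma> le by (auto simp: F_def)
  have "\<Union>C \<in> F" if ne: "C \<noteq> {}" and chain: "subset.chain F C" for C
  proof -
    have CF: "C \<subseteq> F" and lin: "\<And>X Y. X \<in> C \<Longrightarrow> Y \<in> C \<Longrightarrow> X \<subseteq> Y \<or> Y \<subseteq> X"
      using chain by (auto simp: subset_chain_def)
    have "subspace (\<Union>C)"
    proof (rule subspaceI)
      obtain X where "X \<in> C" "subspace X" using ne CF unfolding F_def by blast
      then show "0 \<in> \<Union>C" using subspace_0 by blast
      fix x y assume "x \<in> \<Union>C" "y \<in> \<Union>C"
      then obtain X Y where "x \<in> X" "y \<in> Y" "X \<in> C" "Y \<in> C" by blast
      then obtain Z where "x \<in> Z" "y \<in> Z" "Z \<in> C" using lin by blast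
      moreover from this have "subspace Z" using CF by (auto simp: F_def)
      ultimately show "x + y \<in> \<Union>C" using subspace_add by blast
    next
      fix c x assume "x \<in> \<Union>C"
      then obtain X where "x \<in> X" "X \<in> C" "subspace X" using CF by (auto simp: F_def)
      then show "c *\<^sub>R x \<in> \<Union>C" using subspace_scale by blast
    qed
    moreover have "\<Gamma> \<subseteq> \<Union>C" using ne CF by (auto simp: F_def)
    moreover have "r \<le> s" if "(x, r) \<in> \<Union>C" "(x, s) \<in> S" for x r s
      using that CF by (auto simp: F_def)
    ultimately show ?thesis by (simp add: F_def)
  qed
  then obtain G where G: "G \<in> F" and max: "\<And>X. X \<in> F \<Longrightarrow> G \<subseteq> X \<Longrightarrow> X = G"
    using subset_Zorn_nonempty[of F] \<open>\<Gamma> \<in> F\<close> by blast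
  have Gs: "subspace G" and G\<Gamma>: "\<Gamma> \<subseteq> G" and Gle: "\<And>x r s. (x, r) \<in> G \<Longrightarrow> (x, s) \<in> S \<Longrightarrow> r \<le> s"
    using G by (auto simp: F_def)
  have total: "\<exists>r. (x0, r) \<in> G" for x0
  proof -
    have "\<exists>c. \<forall>y r t s. (y, r) \<in> G \<longrightarrow> (y + t *\<^sub>R x0, s) \<in> S \<longrightarrow> r + t * c \<le> s"
      by (rule extension_constant_exists[OF Gs conv abs]) (fact Gle)
    then obtain c where c: "\<And>y r t s. (y, r) \<in> G \<Longrightarrow> (y + t *\<^sub>R x0, s) \<in> S \<Longrightarrow> r + t * c \<le> s"
      by blast
    define H where "H = {g + h | g h. g \<in> G \<and> h \<in> span {(x0, c)}}"
    have Hs: "subspace H" unfolding H_def by (intro subspace_sums Gs subspace_span)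
    have "g + 0 \<in> H" if "g \<in> G" for g unfolding H_def using that span_zero by blast
    then have GH: "G \<subseteq> H" by auto
    have "r \<le> s" if xr: "(x, r) \<in> H" "(x, s) \<in> S" for x r s
    proof -
      obtain g t where "g \<in> G" "(x, r) = g + t *\<^sub>R (x0, c)"
        using xr(1) unfolding H_def span_singleton by blast
      then show ?thesis using c[of "fst g" "snd g" t s] xr(2) by (cases g) auto
    qed
    then have "H \<in> F" using Hs GH G\<Gamma> by (auto simp: F_def)
    then have "H = G" using max GH by blast
    moreover have "0 + (x0, c) \<in> H" unfolding H_def
      using subspace_0[OF Gs] span_base[of "(x0, c)" "{(x0, c)}"] by blast
    ultimately have "(x0, c) \<in> G" by simp
    then show ?thesis by blast
  qed
  \<comment> \<open>Every multiple of \<open>r\<close> lies below one number \<open>s\<close>, hence a maximal subspace is single-valued.\<close>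
  have zero: "r = 0" if "(0, r) \<in> G" for r
  proof -
    obtain t s where "t > 0" "(t *\<^sub>R (0::'e), s) \<in> S" using abs by blast
    then have 0: "(0, s) \<in> S" by simp
    have "k * r \<le> s" for k
      using Gle[OF _ 0, of "k * r"] subspace_scale[OF Gs that, of k] by simp
    from this[of "(s + 1) / r"] show ?thesis by (cases "r = 0") auto
  qed
  have unique: "r = r'" if "(x, r) \<in> G" "(x, r') \<in> G" for x r r'
    using zero[of "r - r'"] subspace_diff[OF Gs that] by simp
  define L where "L = (\<lambda>x. THE r. (x, r) \<in> G)"
  have L: "(x, L x) \<in> G" for x
    unfolding L_def using total[of x] unique by (metis theI)
  have L_eq: "L x = r" if "(x, r) \<in> G" for x r using unique L that by blast
  have "linear L"
  proof (rule linearI)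
    show "L (x + y) = L x + L y" for x y
      using subspace_add[OF Gs L[of x] L[of y]] by (intro L_eq) simp
    show "L (c *\<^sub>R x) = c *\<^sub>R L x" for c x
      using subspace_scale[OF Gs L[of x], of c] by (intro L_eq) simp
  qed
  then show thesis using that L_eq G\<Gamma> Gle L by blast
qed

lemma linear_bounded_above_imp_blinfun:
  fixes L :: "'e::real_normed_vector \<Rightarrow> real"
  assumes "linear L" "\<And>x. L x \<le> K * norm x"
  obtains f :: "'e \<Rightarrow>\<^sub>L real" where "blinfun_apply f = L" "\<And>x. \<bar>f x\<bar> \<le> K * norm x"
proof -
  have abs: "\<bar>L x\<bar> \<le> K * norm x" for x
    using assms(2)[of x] assms(2)[of "- x"] linear_neg[OF assms(1), of x] by auto
  have "bounded_linear L"
    using abs assms(1) by (intro bounded_linear_intro[of _ K])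
      (auto simp: linear_add linear_scale mult.commute)
  then show thesis using that[of "Blinfun L"] abs by (simp add: bounded_linear_Blinfun_apply)
qed

text \<open>The functional to be extended is given by its graph; the bound makes the graph single-valued. This
form is convenient for functionals that are defined through a choice of images under a relation.\<close>

lemma norm_bounded_extension:
  fixes \<Gamma> :: "('e::real_normed_vector \<times> real) set"
  assumes "subspace \<Gamma>" "\<And>x r. (x, r) \<in> \<Gamma> \<Longrightarrow> r \<le> K * norm x" "K \<ge> 0"
  obtains f :: "'e \<Rightarrow>\<^sub>L real" where "\<And>x r. (x, r) \<in> \<Gamma> \<Longrightarrow> f x = r" "norm f \<le> K"
proof -
  have "convex {(x::'e, s). K * norm x \<le> s}"
  proof (rule convexI, clarsimp)
    fix x y :: 'e and s s' u v :: real
    assume a: "K * norm x \<le> s" "K * norm y \<le> s'" "0 \<le> u" "0 \<le> v"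
    have "K * norm (u *\<^sub>R x + v *\<^sub>R y) \<le> K * (u * norm x + v * norm y)"
      using a \<open>K \<ge> 0\<close> by (intro mult_left_mono norm_triangle_le) auto
    also have "\<dots> = u * (K * norm x) + v * (K * norm y)" by (simp add: algebra_simps)
    also have "\<dots> \<le> u * s + v * s'" using a by (intro add_mono mult_left_mono)
    finally show "K * norm (u *\<^sub>R x + v *\<^sub>R y) \<le> u * s + v * s'" .
  qed
  moreover have "\<exists>t>0. \<exists>s. (t *\<^sub>R x, s) \<in> {(x::'e, s). K * norm x \<le> s}" for x
    by (intro exI[of _ 1]) auto
  moreover have "r \<le> s" if "(x, r) \<in> \<Gamma>" "(x, s) \<in> {(x, s). K * norm x \<le> s}" for x r s
    using assms(2)[OF that(1)] that(2) by simp
  ultimately obtain L where L: "linear L" "\<And>x r. (x, r) \<in> \<Gamma> \<Longrightarrow> L x = r"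
      "\<And>x s. (x, s) \<in> {(x::'e, s). K * norm x \<le> s} \<Longrightarrow> L x \<le> s"
    using hahn_banach_epigraph[OF assms(1)] by blast
  have "L x \<le> K * norm x" for x using L(3) by simp
  obtain f :: "'e \<Rightarrow>\<^sub>L real" where f: "blinfun_apply f = L" "\<And>x. \<bar>f x\<bar> \<le> K * norm x"
    using linear_bounded_above_imp_blinfun[OF L(1)] \<open>\<And>x. L x \<le> K * norm x\<close> by blast
  have "norm f \<le> K" using f(2) \<open>K \<ge> 0\<close> by (intro norm_blinfun_bound) auto
  then show thesis using that[of f] f(1) L(2) by simp
qed

definition annihilator :: "'e::real_normed_vector set \<Rightarrow> 'e dual set" where
  "annihilator D = {f. \<forall>x\<in>D. blinfun_apply f x = 0}"

lemma annihilator_separates: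
  fixes D :: "'e::real_normed_vector set"
  assumes "subspace D" "closed D" "x \<notin> D"
  obtains f where "f \<in> annihilator D" "f x = 1"
proof -
  \<comment> \<open>The functional \<open>d + r x \<mapsto> r\<close> on the span of \<open>D\<close> and \<open>x\<close> has norm at most \<open>1 / \<delta>\<close>.\<close>
  obtain \<delta> where \<delta>: "\<delta> > 0" "ball x \<delta> \<subseteq> - D"
    using assms(2,3) openE[of "- D" x] by auto
  then have \<delta>: "\<delta> > 0" "\<And>d. d \<in> D \<Longrightarrow> dist d x \<ge> \<delta>"
    by (force simp: dist_commute)+
  define \<Gamma> where "\<Gamma> = {g + h | g h. g \<in> D \<times> {0::real} \<and> h \<in> span {(x, 1)}}"
  have "subspace (D \<times> {0::real})"
    using assms(1) by (auto simp: subspace_def zero_prod_def)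
  then have "subspace \<Gamma>" unfolding \<Gamma>_def by (intro subspace_sums subspace_span)
  moreover have "r \<le> (1 / \<delta>) * norm y" if "(y, r) \<in> \<Gamma>" for y r
  proof -
    obtain d where d: "d \<in> D" "y = d + r *\<^sub>R x"
      using \<open>(y, r) \<in> \<Gamma>\<close> unfolding \<Gamma>_def span_singleton by auto
    show ?thesis
    proof (cases "r > 0")
      case True
      have "- (1 / r) *\<^sub>R d \<in> D" using d(1) assms(1) by (intro subspace_scale)
      then have "\<delta> \<le> norm (- (1 / r) *\<^sub>R d - x)" using \<delta>(2) by (simp only: dist_norm)
      then have "r * \<delta> \<le> norm (r *\<^sub>R (- (1 / r) *\<^sub>R d - x))" using True by simp
      also have "r *\<^sub>R (- (1 / r) *\<^sub>R d - x) = - y" using True d(2) by (simp add: algebra_simps)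
      finally show ?thesis using \<delta>(1) by (simp add: field_simps)
    next
      case False
      moreover have "0 \<le> (1 / \<delta>) * norm y" using \<delta>(1) by simp
      ultimately show ?thesis by linarith
    qed
  qed
  ultimately obtain f :: "'e \<Rightarrow>\<^sub>L real" where f: "\<And>y r. (y, r) \<in> \<Gamma> \<Longrightarrow> f y = r"
    using norm_bounded_extension[of \<Gamma> "1 / \<delta>"] \<delta>(1) by (metis less_imp_le zero_less_divide_1_iff)
  have mem: "(d, 0) + t *\<^sub>R (x, 1) \<in> \<Gamma>" if "d \<in> D" for d t
    unfolding \<Gamma>_def span_singleton using that by blast
  have "f d = 0" if "d \<in> D" for d using f[of d 0] mem[OF that, of 0] by simp
  moreover have "f x = 1" using f[of x 1] mem[OF subspace_0[OF assms(1)], of 1] by simp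
  ultimately show thesis using that[of f] by (auto simp: annihilator_def)
qed

text \<open>An element of the bidual that vanishes on the annihilator of \<open>D\<close> acts as an element of the bidual
of \<open>D\<close> of the same norm: it sees a functional only through its restriction to \<open>D\<close>.\<close>

lemma biannihilator_bound:
  fixes z :: "'e::real_normed_vector bidual" and s :: "'e dual"
  assumes D: "subspace D" and z: "\<And>f. f \<in> annihilator D \<Longrightarrow> z f = 0"
    and s: "\<And>d. d \<in> D \<Longrightarrow> \<bar>s d\<bar> \<le> K * norm d" and K: "K \<ge> 0"
  shows "\<bar>z s\<bar> \<le> norm z * K"
proof -
  have "subspace ((\<lambda>d. (d, s d)) ` D)"
    using D by (intro linear_subspace_image linearI) (auto simp: blinfun.add_right blinfun.scaleR_right)
  moreover have "r \<le> K * norm x" if "(x, r) \<in> (\<lambda>d. (d, s d)) ` D" for x r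
    using s[of x] that by auto
  ultimately obtain f :: "'e dual"
    where "\<And>x r. (x, r) \<in> (\<lambda>d. (d, s d)) ` D \<Longrightarrow> f x = r" and fK: "norm f \<le> K"
    using norm_bounded_extension[of "(\<lambda>d. (d, s d)) ` D" K] K by blast
  then have f: "\<And>d. d \<in> D \<Longrightarrow> f d = s d" by blast
  have "z (s - f) = 0" using f by (intro z) (auto simp: annihilator_def blinfun.diff_left)
  then have "z s = z f" by (simp add: blinfun.diff_right)
  also have "\<bar>z f\<bar> \<le> norm z * norm f" using norm_blinfun[of z f] by simp
  also have "\<dots> \<le> norm z * K" using fK by (intro mult_left_mono) auto
  finally show ?thesis .
qed

lemma functional_in_span_of_finite:
  fixes l :: "'e::real_vector \<Rightarrow> real" and ev :: "'i \<Rightarrow> 'e \<Rightarrow> real"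
  assumes "finite F" "linear l" "\<And>f. linear (ev f)"
    and "\<And>v. (\<forall>f\<in>F. ev f v = 0) \<Longrightarrow> l v = 0"
  shows "\<exists>c. \<forall>v. l v = (\<Sum>f\<in>F. c f * ev f v)"
  using assms(1,2,4)
proof (induction F arbitrary: l rule: finite_induct)
  case empty
  then show ?case by simp
next
  case (insert g F)
  show ?case
  proof (cases "\<exists>u. ev g u \<noteq> 0 \<and> (\<forall>f\<in>F. ev f u = 0)")
    case False
    then have "\<exists>c. \<forall>v. l v = (\<Sum>f\<in>F. c f * ev f v)"
      using insert.prems by (intro insert.IH) auto
    then obtain c where c: "\<And>v. l v = (\<Sum>f\<in>F. c f * ev f v)" by blast
    have "l v = (\<Sum>f\<in>insert g F. (c(g := 0)) f * ev f v)" for v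
      using insert.hyps c[of v] by (auto intro!: sum.cong)
    then show ?thesis by blast
  next
    case True
    then obtain u where u: "ev g u \<noteq> 0" "\<And>f. f \<in> F \<Longrightarrow> ev f u = 0" by blast
    define k where "k = l u / ev g u"
    have "\<exists>c. \<forall>v. l v - k * ev g v = (\<Sum>f\<in>F. c f * ev f v)"
    proof (rule insert.IH)
      show "linear (\<lambda>v. l v - k * ev g v)"
        using insert.prems(1) assms(3)[of g] by (auto simp: linear_iff algebra_simps)
      fix v assume v: "\<forall>f\<in>F. ev f v = 0"
      \<comment> \<open>Moving \<open>v\<close> along \<open>u\<close> into the kernel of \<open>ev g\<close> leaves the other functionals zero.\<close>
      define w where "w = v - (ev g v / ev g u) *\<^sub>R u"
      have "ev f w = ev f v - (ev g v / ev g u) * ev f u" for f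
        unfolding w_def by (simp add: linear_diff[OF assms(3)] linear_scale[OF assms(3)])
      then have "\<forall>f\<in>insert g F. ev f w = 0" using u v by auto
      then have "l w = 0" by (rule insert.prems(2))
      then show "l v - k * ev g v = 0"
        unfolding w_def k_def by (simp add: linear_diff[OF insert.prems(1)] linear_scale[OF insert.prems(1)])
    qed
    then obtain c where c: "\<And>v. l v - k * ev g v = (\<Sum>f\<in>F. c f * ev f v)" by blast
    have "(\<Sum>f\<in>F. (c(g := k)) f * ev f v) = (\<Sum>f\<in>F. c f * ev f v)" for v
      using insert.hyps by (intro sum.cong) auto
    then have "l v = (\<Sum>f\<in>insert g F. (c(g := k)) f * ev f v)" for v
      using insert.hyps c[of v] by simp
    then show ?thesis by blast
  qed
qed

section \<open>Boundedness of closed linear relations\<close>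

lemma subspace_fst_image: "subspace G \<Longrightarrow> subspace (fst ` G)"
  by (rule linear_subspace_image) (rule linear_fst)

text \<open>The closed graph theorem for relations. By Baire's theorem, over some ball of the domain
a dense set of points has images of bounded norm. Linearity turns this into a uniform approximation
property at every point, and summing up the successive corrections gives exact images, since the graph is
closed.\<close>

theorem closed_relation_bounded:
  fixes G :: "('a::banach \<times> 'b::banach) set"
  assumes G: "subspace G" "closed G" and D: "closed (fst ` G)"
  obtains C where "C \<ge> 0" "\<And>x. x \<in> fst ` G \<Longrightarrow> \<exists>y. (x, y) \<in> G \<and> norm y \<le> C * norm x"
proof -
  define E where "E n = {x. \<exists>y. (x, y) \<in> G \<and> norm y \<le> real n}" for n :: nat
  have zero: "0 \<in> fst ` G" using subspace_0[OF subspace_fst_image[OF G(1)]] .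
  have ED: "closure (E n) \<subseteq> fst ` G" for n
    using D by (intro closure_minimal) (force simp: E_def)
  have cover: "\<Union>(range (\<lambda>n. closure (E n))) = fst ` G"
  proof
    show "fst ` G \<subseteq> \<Union>(range (\<lambda>n. closure (E n)))"
    proof
      fix x assume "x \<in> fst ` G"
      then obtain y where "(x, y) \<in> G" by force
      moreover obtain n where "norm y \<le> real n" using real_arch_simple by blast
      ultimately have "x \<in> E n" by (auto simp: E_def)
      then show "x \<in> \<Union>(range (\<lambda>n. closure (E n)))" using closure_subset by blast
    qed
  qed (use ED in blast)
  have "\<exists>n. (top_of_set (fst ` G)) interior_of (closure (E n)) \<noteq> {}"
  proof (rule ccontr)
    assume "\<not> ?thesis"
    moreover have "completely_metrizable_space (top_of_set (fst ` G))"
      using D by (intro completely_metrizable_space_closedin completely_metrizable_space_euclidean) auto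
    ultimately have "(top_of_set (fst ` G)) interior_of (\<Union>(range (\<lambda>n. closure (E n)))) = {}"
      by (intro Baire_category_alt) (auto intro: closed_subset[OF ED closed_closure])
    then show False unfolding cover using zero interior_of_topspace[of "top_of_set (fst ` G)"] by auto
  qed
  then obtain n c where c: "c \<in> (top_of_set (fst ` G)) interior_of (closure (E n))" by blast
  then obtain U where U: "openin (top_of_set (fst ` G)) U" "c \<in> U" "U \<subseteq> closure (E n)"
    unfolding interior_of_def by blast
  then have cD: "c \<in> fst ` G" using openin_imp_subset by blast
  obtain \<epsilon> where \<epsilon>: "\<epsilon> > 0" "ball c \<epsilon> \<inter> fst ` G \<subseteq> closure (E n)"
    using U unfolding openin_contains_ball by (meson order_trans)
  \<comment> \<open>Differences of points near \<open>c + d\<close> and near \<open>c\<close> move the ball from \<open>c\<close> to the origin.\<close>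
  have near: "\<exists>x y. (x, y) \<in> G \<and> norm y \<le> 2 * real n \<and> norm (d - x) < \<eta>"
    if d: "d \<in> fst ` G" "norm d < \<epsilon>" and \<eta>: "\<eta> > 0" for d \<eta>
  proof -
    have "c + d \<in> fst ` G" using cD d(1) subspace_add subspace_fst_image[OF G(1)] by blast
    then have "c + d \<in> ball c \<epsilon> \<inter> fst ` G" "c \<in> ball c \<epsilon> \<inter> fst ` G"
      using \<epsilon>(1) d(2) cD by (auto simp: dist_norm simp del: image_iff)
    then have "c + d \<in> closure (E n)" "c \<in> closure (E n)" using \<epsilon>(2) by blast+
    then obtain u v where uv: "u \<in> E n" "dist u (c + d) < \<eta> / 2" "v \<in> E n" "dist v c < \<eta> / 2"
      using \<eta> unfolding closure_approachable by (meson half_gt_zero)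
    then obtain u' v' where u'v': "(u, u') \<in> G" "norm u' \<le> real n" "(v, v') \<in> G" "norm v' \<le> real n"
      unfolding E_def by blast
    have "(u, u') - (v, v') \<in> G" using u'v' G(1) by (intro subspace_diff)
    moreover have "norm (u' - v') \<le> 2 * real n"
      using u'v' norm_triangle_ineq4[of u' v'] by linarith
    moreover have "norm (d - (u - v)) < \<eta>"
    proof -
      have "d - (u - v) = (v - c) - (u - (c + d))" by simp
      then have "norm (d - (u - v)) \<le> norm (v - c) + norm (u - (c + d))"
        using norm_triangle_ineq4 by metis
      then show ?thesis using uv by (simp add: dist_norm)
    qed
    ultimately show ?thesis by auto
  qed
  define K where "K = 4 * real n / \<epsilon>"
  have "K \<ge> 0" using \<epsilon>(1) by (simp add: K_def)
  have approx: "\<exists>g\<in>G. norm (snd g) \<le> K * norm d \<and> norm (d - fst g) \<le> norm d / 2"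
    if d: "d \<in> fst ` G" for d
  proof (cases "d = 0")
    case True
    then show ?thesis using subspace_0[OF G(1)] by (intro bexI[of _ 0]) auto
  next
    case False
    define t where "t = \<epsilon> / (2 * norm d)"
    have t: "t > 0" using \<epsilon>(1) False by (simp add: t_def)
    have "t *\<^sub>R d \<in> fst ` G" using d subspace_scale subspace_fst_image[OF G(1)] by blast
    moreover have "norm (t *\<^sub>R d) < \<epsilon>" using False \<epsilon>(1) by (simp add: t_def)
    moreover have "\<epsilon> / 4 > 0" using \<epsilon>(1) by simp
    ultimately obtain x y where xy: "(x, y) \<in> G" "norm y \<le> 2 * real n" "norm (t *\<^sub>R d - x) < \<epsilon> / 4"
      using near by blast
    have "(1 / t) *\<^sub>R (x, y) \<in> G" using xy(1) G(1) by (intro subspace_scale)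
    moreover have "norm ((1 / t) *\<^sub>R y) \<le> K * norm d"
      using xy(2) \<epsilon>(1) False by (simp add: t_def K_def field_simps)
    moreover have "norm (d - (1 / t) *\<^sub>R x) \<le> norm d / 2"
    proof -
      have "d - (1 / t) *\<^sub>R x = (1 / t) *\<^sub>R (t *\<^sub>R d - x)" using t by (simp add: algebra_simps)
      then have "norm (d - (1 / t) *\<^sub>R x) = (1 / t) * norm (t *\<^sub>R d - x)" using t by simp
      also have "\<dots> \<le> (1 / t) * (\<epsilon> / 4)" using xy(3) t by (intro mult_left_mono) auto
      also have "\<dots> = norm d / 2" using \<epsilon>(1) False by (simp add: t_def)
      finally show ?thesis .
    qed
    ultimately show ?thesis by (intro bexI[of _ "(1 / t) *\<^sub>R (x, y)"]) auto
  qed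
  then obtain f where f: "\<And>d. d \<in> fst ` G \<Longrightarrow> f d \<in> G"
      "\<And>d. d \<in> fst ` G \<Longrightarrow> norm (snd (f d)) \<le> K * norm d"
      "\<And>d. d \<in> fst ` G \<Longrightarrow> norm (d - fst (f d)) \<le> norm d / 2"
    by metis
  have "\<exists>y. (d, y) \<in> G \<and> norm y \<le> 2 * K * norm d" if d: "d \<in> fst ` G" for d
  proof -
    \<comment> \<open>The remainder after \<open>k\<close> corrections; its norm is halved in each step.\<close>
    define r where "r k = ((\<lambda>d. d - fst (f d)) ^^ k) d" for k
    have r_Suc: "r (Suc k) = r k - fst (f (r k))" for k by (simp add: r_def)
    have r: "r k \<in> fst ` G \<and> norm (r k) \<le> norm d * (1 / 2) ^ k" for k
    proof (induction k)
      case (Suc k)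
      then have "r (Suc k) \<in> fst ` G"
        unfolding r_Suc using f(1) by (intro subspace_diff subspace_fst_image G(1)) auto
      moreover have "norm (r (Suc k)) \<le> norm (r k) / 2" unfolding r_Suc using f(3) Suc by blast
      ultimately show ?case using Suc by auto
    qed (simp add: r_def d)
    define Y where "Y k = snd (f (r k))" for k
    have Y: "norm (Y k) \<le> K * norm d * (1 / 2) ^ k" for k
    proof -
      have "norm (Y k) \<le> K * norm (r k)" unfolding Y_def using f(2) r by blast
      also have "\<dots> \<le> K * (norm d * (1 / 2) ^ k)" using r \<open>K \<ge> 0\<close> by (intro mult_left_mono) auto
      finally show ?thesis by simp
    qed
    have geo: "(\<lambda>k. K * norm d * (1 / 2) ^ k) sums (K * norm d * 2)"
      using sums_mult[OF geometric_sums[of "1 / 2 :: real"], of "K * norm d"] by simp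
    have sumY: "summable (\<lambda>k. norm (Y k))"
      by (rule summable_comparison_test'[OF sums_summable[OF geo], of 0]) (simp add: Y)
    have partial: "(d - r k, \<Sum>j<k. Y j) \<in> G" for k
    proof (induction k)
      case 0
      then show ?case using subspace_0[OF G(1)] by (simp add: r_def zero_prod_def)
    next
      case (Suc k)
      have "(d - r k, \<Sum>j<k. Y j) + f (r k) \<in> G" using Suc f(1) r G(1) by (intro subspace_add) auto
      then show ?case by (simp add: r_Suc Y_def plus_prod_def algebra_simps)
    qed
    have "(\<lambda>k. norm d * (1 / 2) ^ k) \<longlonglongrightarrow> norm d * 0"
      by (intro tendsto_mult_left LIMSEQ_realpow_zero) auto
    then have "(\<lambda>k. norm d * (1 / 2) ^ k) \<longlonglongrightarrow> 0" by simp
    then have "r \<longlonglongrightarrow> 0" by (rule Lim_null_comparison[rotated]) (simp add: r)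
    then have lim: "(\<lambda>k. (d - r k, \<Sum>j<k. Y j)) \<longlonglongrightarrow> (d - 0, suminf Y)"
      using summable_LIMSEQ[OF summable_norm_cancel[OF sumY]] by (intro tendsto_Pair tendsto_diff tendsto_const)
    have "(d, suminf Y) \<in> G"
      using closed_sequentially[OF G(2) partial lim] by simp
    moreover have "norm (suminf Y) \<le> 2 * K * norm d"
    proof -
      have "norm (suminf Y) \<le> (\<Sum>k. norm (Y k))" using sumY by (rule summable_norm)
      also have "\<dots> \<le> (\<Sum>k. K * norm d * (1 / 2) ^ k)"
        using Y sumY sums_summable[OF geo] by (intro suminf_le)
      also have "\<dots> = 2 * K * norm d" using sums_unique[OF geo] by simp
      finally show ?thesis .
    qed
    ultimately show ?thesis by blast
  qed
  then show thesis using that[of "2 * K"] \<open>K \<ge> 0\<close> by auto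
qed

section \<open>Semidefinite forms and approximate Riesz representation\<close>

lemma quadratic_nonneg_discriminant:
  fixes a b c :: real
  assumes "\<And>t. a * t\<^sup>2 + 2 * b * t + c \<ge> 0" "a \<ge> 0"
  shows "b\<^sup>2 \<le> a * c"
proof (cases "a = 0")
  case True
  have "b = 0"
  proof (rule ccontr)
    assume "b \<noteq> 0"
    then show False using assms(1)[of "- (c + 1) / (2 * b)"] True by simp
  qed
  then show ?thesis using True by simp
next
  case False
  then have "a > 0" using assms(2) by simp
  have "a * (- b / a)\<^sup>2 + 2 * b * (- b / a) + c = c - b\<^sup>2 / a"
    using False by (simp add: power2_eq_square field_simps)
  then have "b\<^sup>2 / a \<le> c" using assms(1)[of "- b / a"] by linarith
  then show ?thesis using \<open>a > 0\<close> by (simp add: field_simps)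
qed

lemma le_sqrt_error_imp_le_zero:
  fixes d :: real
  assumes "\<And>\<epsilon>. 0 < \<epsilon> \<Longrightarrow> \<epsilon> \<le> 1 \<Longrightarrow> d \<le> a * \<epsilon> + b * sqrt (c * \<epsilon>)"
  shows "d \<le> 0"
proof (rule tendsto_lowerbound)
  have "((\<lambda>\<epsilon>. a * \<epsilon> + b * sqrt (c * \<epsilon>)) \<longlongrightarrow> a * 0 + b * sqrt (c * 0)) (at_right 0)"
    by (intro tendsto_intros)
  then show "((\<lambda>\<epsilon>. a * \<epsilon> + b * sqrt (c * \<epsilon>)) \<longlongrightarrow> 0) (at_right 0)" by simp
  show "\<forall>\<^sub>F \<epsilon> in at_right 0. d \<le> a * \<epsilon> + b * sqrt (c * \<epsilon>)"
    using assms unfolding eventually_at_right_field by (intro exI[of _ 1]) auto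
qed simp

text \<open>Linearity is demanded on the ambient space, symmetry and positivity only on \<open>V\<close>: the forms
considered below are restrictions of duality pairings to graphs.\<close>

locale psd_form =
  fixes V :: "'v::real_vector set" and B :: "'v \<Rightarrow> 'v \<Rightarrow> real"
  assumes subspace: "subspace V"
    and linear_left: "\<And>g. linear (\<lambda>f. B f g)"
    and linear_right: "\<And>f. linear (B f)"
    and sym: "\<And>f g. f \<in> V \<Longrightarrow> g \<in> V \<Longrightarrow> B f g = B g f"
    and nonneg: "\<And>f. f \<in> V \<Longrightarrow> B f f \<ge> 0"
begin

lemma expand:
  assumes "f \<in> V" "g \<in> V"
  shows "B (f + t *\<^sub>R g) (f + t *\<^sub>R g) = B f f + 2 * t * B f g + t\<^sup>2 * B g g"
  using sym[OF assms]
  by (simp add: linear_add[OF linear_left] linear_add[OF linear_right]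
      linear_scale[OF linear_left] linear_scale[OF linear_right] power2_eq_square algebra_simps)

lemma combination_mem: "f \<in> V \<Longrightarrow> g \<in> V \<Longrightarrow> f + t *\<^sub>R g \<in> V"
  using subspace by (intro subspace_add subspace_scale)

lemma cauchy_schwarz:
  assumes "f \<in> V" "g \<in> V"
  shows "(B f g)\<^sup>2 \<le> B g g * B f f"
  using nonneg[OF combination_mem[OF assms]] nonneg[OF assms(2)]
  by (intro quadratic_nonneg_discriminant) (auto simp: expand[OF assms] algebra_simps)

text \<open>An almost minimiser \<open>f\<close> of \<open>B g g - 2 * L g\<close> represents \<open>L\<close> up to a small error. Exact
representation would need completeness of \<open>V\<close> in the seminorm of \<open>B\<close>, which fails in general; the
bound on \<open>B f f\<close> controls the error at \<open>f\<close> itself.\<close>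

lemma approximate_riesz:
  assumes L: "linear L" "\<And>g. g \<in> V \<Longrightarrow> (L g)\<^sup>2 \<le> M * B g g" and \<epsilon>: "\<epsilon> > 0" and M: "M \<ge> 0"
  obtains f where "f \<in> V" "\<And>g. g \<in> V \<Longrightarrow> \<bar>L g - B f g\<bar> \<le> \<epsilon> * sqrt (B g g)"
    "sqrt (B f f) \<le> sqrt M + \<epsilon>"
proof -
  define J where "J g = B g g - 2 * L g" for g
  have "J g \<ge> - M" if "g \<in> V" for g
  proof -
    have "\<bar>L g\<bar> \<le> sqrt M * sqrt (B g g)"
      using L(2)[OF that] real_sqrt_le_mono by (fastforce simp: real_sqrt_mult)
    moreover have "2 * (sqrt M * sqrt (B g g)) \<le> M + B g g"
      using sum_squares_bound[of "sqrt M" "sqrt (B g g)"] M nonneg[OF that] by simp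
    ultimately show ?thesis unfolding J_def by linarith
  qed
  then have bdd: "bdd_below (J ` V)" by (auto intro!: bdd_belowI)
  have "J ` V \<noteq> {}" using subspace_0[OF subspace] by blast
  then obtain f where f: "f \<in> V" "J f < Inf (J ` V) + \<epsilon>\<^sup>2"
    using cInf_lessD[of "J ` V" "Inf (J ` V) + \<epsilon>\<^sup>2"] \<epsilon> by auto
  have err: "\<bar>L g - B f g\<bar> \<le> \<epsilon> * sqrt (B g g)" if g: "g \<in> V" for g
  proof -
    have "B g g * t\<^sup>2 + 2 * (B f g - L g) * t + \<epsilon>\<^sup>2 \<ge> 0" for t
    proof -
      have "Inf (J ` V) \<le> J (f + t *\<^sub>R g)"
        using bdd combination_mem[OF f(1) g] by (intro cInf_lower) auto
      then have "J f - \<epsilon>\<^sup>2 \<le> J (f + t *\<^sub>R g)" using f(2) by linarith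
      then show ?thesis
        unfolding J_def expand[OF f(1) g] linear_add[OF L(1)] linear_scale[OF L(1)]
        by (simp add: algebra_simps)
    qed
    then have "(B f g - L g)\<^sup>2 \<le> B g g * \<epsilon>\<^sup>2"
      using nonneg[OF g] by (intro quadratic_nonneg_discriminant)
    then have "\<bar>B f g - L g\<bar> \<le> sqrt (B g g * \<epsilon>\<^sup>2)" using real_sqrt_le_mono by fastforce
    then show ?thesis using \<epsilon> by (simp add: real_sqrt_mult abs_minus_commute mult.commute)
  qed
  have "sqrt (B f f) \<le> sqrt M + \<epsilon>"
  proof (cases "B f f = 0")
    case True
    then show ?thesis using M \<epsilon> by simp
  next
    case False
    then have pos: "sqrt (B f f) > 0" using nonneg[OF f(1)] by simp
    have "B f f \<le> \<bar>L f\<bar> + \<epsilon> * sqrt (B f f)" using err[OF f(1)] by linarith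
    also have "\<bar>L f\<bar> \<le> sqrt M * sqrt (B f f)"
      using L(2)[OF f(1)] real_sqrt_le_mono by (fastforce simp: real_sqrt_mult)
    finally have "sqrt (B f f) * sqrt (B f f) \<le> (sqrt M + \<epsilon>) * sqrt (B f f)"
      using nonneg[OF f(1)] by (simp add: distrib_right)
    then show ?thesis using mult_right_le_imp_le[OF _ pos] by blast
  qed
  then show thesis using that[OF f(1) err] by blast
qed

end

section \<open>Graphs, adjoints and maximality\<close>

lemma canon_apply [simp]: "blinfun_apply (canon x) f = blinfun_apply f x"
  by (simp add: canon.rep_eq)

lemma canon_zero [simp]: "canon 0 = 0"
  by (rule blinfun_eqI) simp

lemma norm_canon_le: "norm (canon x) \<le> norm x"
proof (rule norm_blinfun_bound)
  show "norm (canon x f) \<le> norm x * norm f" for f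
    using norm_blinfun[of f x] by (simp add: mult.commute)
qed simp

lemma mem_gra: "(x, y) \<in> gra A \<longleftrightarrow> y \<in> A x"
  by (simp add: gra_def)

lemma fst_gra: "fst ` gra A = dom A"
  by (force simp: gra_def dom_def)

lemma domI: "(x, y) \<in> gra A \<Longrightarrow> x \<in> dom A"
  by (auto simp: gra_def dom_def)

lemma domE: assumes "x \<in> dom A" obtains y where "(x, y) \<in> gra A"
  using assms by (auto simp: gra_def dom_def)

lemma mem_gra_adjoint:
  "(z, z') \<in> gra (adjoint_rel A) \<longleftrightarrow> (\<forall>a a'. (a, a') \<in> gra A \<longrightarrow> z' a = z a')"
  by (auto simp: mem_gra adjoint_rel_def)

lemma subspace_gra_adjoint: "subspace (gra (adjoint_rel A))"
  by (auto intro!: subspaceI simp: zero_prod_def plus_prod_def scaleR_prod_def mem_gra_adjoint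
      blinfun.add_left blinfun.scaleR_left)

lemma adjoint_rel_zero: "adjoint_rel A 0 = annihilator (dom A)"
  by (auto simp: adjoint_rel_def annihilator_def dom_def gra_def)

lemma bidual_monotone_adjoint_iff:
  "bidual_monotone (adjoint_rel A) \<longleftrightarrow> (\<forall>z z'. (z, z') \<in> gra (adjoint_rel A) \<longrightarrow> 0 \<le> z z')"
proof
  assume "bidual_monotone (adjoint_rel A)"
  moreover have "(0, 0) \<in> gra (adjoint_rel A)"
    using subspace_0[OF subspace_gra_adjoint] by (simp add: zero_prod_def)
  ultimately show "\<forall>z z'. (z, z') \<in> gra (adjoint_rel A) \<longrightarrow> 0 \<le> z z'"
    unfolding bidual_monotone_def bidual_monotone_set_def by fastforce
next
  assume *: "\<forall>z z'. (z, z') \<in> gra (adjoint_rel A) \<longrightarrow> 0 \<le> z z'"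
  have "0 \<le> (x - y) (x' - y')"
    if "(x, x') \<in> gra (adjoint_rel A)" "(y, y') \<in> gra (adjoint_rel A)" for x x' y y'
    using * subspace_diff[OF subspace_gra_adjoint that] by simp
  then show "bidual_monotone (adjoint_rel A)"
    unfolding bidual_monotone_def bidual_monotone_set_def by blast
qed

lemma pairing_neg_neg: "blinfun_apply (x' - y') (x - y) = blinfun_apply (y' - x') (y - x)"
  by (simp add: blinfun.diff_left blinfun.diff_right)

text \<open>Maximality is tested on single points: a point that is monotonically related to the graph could be
adjoined to it.\<close>

lemma maximally_monotone_wrt_iff:
  "maximally_monotone_wrt A U V \<longleftrightarrow> monotone_wrt A U V \<and>
    (\<forall>x\<in>U. \<forall>x'\<in>V. (\<forall>a\<in>U. \<forall>a'\<in>V. (a, a') \<in> gra A \<longrightarrow> 0 \<le> (a' - x') (a - x)) \<longrightarrow> (x, x') \<in> gra A)"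
    (is "_ \<longleftrightarrow> _ \<and> ?related")
proof (intro iffI conjI)
  assume max: "maximally_monotone_wrt A U V"
  then show mono: "monotone_wrt A U V" by (simp add: maximally_monotone_wrt_def)
  show ?related
  proof (intro ballI impI)
    fix x x' assume x: "x \<in> U" "x' \<in> V"
      and rel: "\<forall>a\<in>U. \<forall>a'\<in>V. (a, a') \<in> gra A \<longrightarrow> 0 \<le> (a' - x') (a - x)"
    define B where "B y = {y'. (y, y') \<in> insert (x, x') (gra A)}" for y
    have B: "gra B = insert (x, x') (gra A)" by (auto simp: B_def gra_def)
    have "0 \<le> (p' - q') (p - q)"
      if p: "(p, p') \<in> gra B" "p \<in> U" "p' \<in> V" and q: "(q, q') \<in> gra B" "q \<in> U" "q' \<in> V" for p p' q q'
    proof -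
      consider "(p, p') = (x, x')" "(q, q') = (x, x')" | "(p, p') = (x, x')" "(q, q') \<in> gra A"
        | "(p, p') \<in> gra A" "(q, q') = (x, x')" | "(p, p') \<in> gra A" "(q, q') \<in> gra A"
        using p(1) q(1) unfolding B by blast
      then show ?thesis
      proof cases
        case 1 then show ?thesis by simp
      next
        case 2 then show ?thesis using rel q pairing_neg_neg[of p' q' p q] by auto
      next
        case 3 then show ?thesis using rel p by auto
      next
        case 4 then show ?thesis using mono p q unfolding monotone_wrt_def by blast
      qed
    qed
    then have "monotone_wrt B U V" unfolding monotone_wrt_def by blast
    then have "gra A \<inter> (U \<times> V) = gra B \<inter> (U \<times> V)"
      using max B unfolding maximally_monotone_wrt_def by blast
    then show "(x, x') \<in> gra A" using B x by blast
  qed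
next
  assume "monotone_wrt A U V \<and> ?related"
  then have mono: "monotone_wrt A U V" and rel: ?related by blast+
  show "maximally_monotone_wrt A U V"
    unfolding maximally_monotone_wrt_def
  proof (intro conjI mono allI impI)
    fix B :: "'a \<Rightarrow> 'a dual set"
    assume B: "monotone_wrt B U V \<and> gra A \<inter> (U \<times> V) \<subseteq> gra B \<inter> (U \<times> V)"
    have "(x, x') \<in> gra A" if x: "(x, x') \<in> gra B" "x \<in> U" "x' \<in> V" for x x'
    proof -
      have "0 \<le> (a' - x') (a - x)" if "a \<in> U" "a' \<in> V" "(a, a') \<in> gra A" for a a'
      proof -
        have "(a, a') \<in> gra B" using that B by blast
        then show ?thesis using B x that unfolding monotone_wrt_def by blast
      qed
      then show ?thesis using rel x by blast
    qed
    then show "gra A \<inter> (U \<times> V) = gra B \<inter> (U \<times> V)" using B by auto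
  qed
qed

lemma maximally_monotone_imp_closed_gra:
  assumes "maximally_monotone A"
  shows "closed (gra A)"
proof -
  have "gra A = (\<Inter>(a, a')\<in>gra A. {p. 0 \<le> blinfun_apply (a' - snd p) (a - fst p)})"
  proof (intro equalityI subsetI)
    fix p assume "p \<in> gra A"
    then show "p \<in> (\<Inter>(a, a')\<in>gra A. {p. 0 \<le> blinfun_apply (a' - snd p) (a - fst p)})"
      using assms unfolding maximally_monotone_wrt_def monotone_wrt_def by (cases p) fastforce
  next
    fix p assume "p \<in> (\<Inter>(a, a')\<in>gra A. {p. 0 \<le> blinfun_apply (a' - snd p) (a - fst p)})"
    then have "\<forall>a a'. (a, a') \<in> gra A \<longrightarrow> 0 \<le> (a' - snd p) (a - fst p)" by blast
    then have "(fst p, snd p) \<in> gra A" using assms unfolding maximally_monotone_wrt_iff by blast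
    then show "p \<in> gra A" by simp
  qed
  moreover have "closed (\<Inter>(a, a')\<in>gra A. {p. 0 \<le> blinfun_apply (a' - snd p) (a - fst p)})"
    by (intro closed_INT ballI) (auto intro!: closed_Collect_le continuous_intros)
  ultimately show ?thesis by simp
qed

text \<open>A functional on a graph that is controlled by the first component depends only on that component.\<close>

lemma functional_on_domain:
  fixes G :: "('a::real_normed_vector \<times> 'b::real_vector) set"
  assumes G: "subspace G" and e: "linear e" "\<And>g. g \<in> G \<Longrightarrow> e g \<le> K * norm (fst g)" and K: "K \<ge> 0"
  obtains f :: "'a dual" where "\<And>g. g \<in> G \<Longrightarrow> f (fst g) = e g" "norm f \<le> K"
proof -
  have "linear (\<lambda>g. (fst g, e g))"
    using e(1) by (auto simp: linear_iff)
  then have "subspace ((\<lambda>g. (fst g, e g)) ` G)" using G by (rule linear_subspace_image)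
  moreover have "r \<le> K * norm x" if "(x, r) \<in> (\<lambda>g. (fst g, e g)) ` G" for x r
    using e(2) that by auto
  ultimately obtain f :: "'a dual"
    where f: "\<And>x r. (x, r) \<in> (\<lambda>g. (fst g, e g)) ` G \<Longrightarrow> f x = r" "norm f \<le> K"
    using norm_bounded_extension[of "(\<lambda>g. (fst g, e g)) ` G" K] K by blast
  have "f (fst g) = e g" if "g \<in> G" for g using f(1) that by blast
  then show thesis using that f(2) by blast
qed

text \<open>The polar form of \<open>(a, a') \<mapsto> a' a\<close>.\<close>

definition energy :: "'a::real_normed_vector \<times> 'a dual \<Rightarrow> 'a \<times> 'a dual \<Rightarrow> real" where
  "energy g h = (snd h (fst g) + snd g (fst h)) / 2"

definition dual_energy :: "'a::real_normed_vector bidual \<times> 'a dual \<Rightarrow> 'a bidual \<times> 'a dual \<Rightarrow> real" where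
  "dual_energy g h = (fst g (snd h) + fst h (snd g)) / 2"

lemma psd_form_dual_energy:
  assumes "bidual_monotone (adjoint_rel A)"
  shows "psd_form (gra (adjoint_rel A)) dual_energy"
proof
  show "subspace (gra (adjoint_rel A))" by (rule subspace_gra_adjoint)
  show "0 \<le> dual_energy f f" if "f \<in> gra (adjoint_rel A)" for f
    using assms that unfolding bidual_monotone_adjoint_iff by (cases f) (auto simp: dual_energy_def)
qed (auto intro!: linearI simp: dual_energy_def blinfun.add_left blinfun.add_right
    blinfun.scaleR_left blinfun.scaleR_right field_simps)

section \<open>Monotone linear relations\<close>

locale monotone_linear_relation =
  fixes A :: "'a::real_normed_vector \<Rightarrow> 'a dual set"
  assumes linear: "linear_relation A" and mono: "monotone_op A"
begin

lemma subspace_gra: "subspace (gra A)"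
  using linear by (simp add: linear_relation_def)

lemma zero_mem: "(0, 0) \<in> gra A"
  using subspace_0[OF subspace_gra] by (simp add: zero_prod_def)

lemma scale_mem: "(a, a') \<in> gra A \<Longrightarrow> (t *\<^sub>R a, t *\<^sub>R a') \<in> gra A"
  using subspace_scale[OF subspace_gra, of "(a, a')" t] by simp

lemma add_mem: "(a, a') \<in> gra A \<Longrightarrow> (b, b') \<in> gra A \<Longrightarrow> (a + b, a' + b') \<in> gra A"
  using subspace_add[OF subspace_gra, of "(a, a')" "(b, b')"] by simp

lemma diff_mem: "(a, a') \<in> gra A \<Longrightarrow> (b, b') \<in> gra A \<Longrightarrow> (a - b, a' - b') \<in> gra A"
  using subspace_diff[OF subspace_gra, of "(a, a')" "(b, b')"] by simp

lemma nonneg: "(a, a') \<in> gra A \<Longrightarrow> 0 \<le> a' a"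
  using mono zero_mem unfolding monotone_wrt_def by fastforce

lemma subspace_dom: "subspace (dom A)"
  using subspace_fst_image[OF subspace_gra] by (simp add: fst_gra)

sublocale energy: psd_form "gra A" energy
proof
  show "subspace (gra A)" by (rule subspace_gra)
  show "0 \<le> energy f f" if "f \<in> gra A" for f
    using nonneg that by (cases f) (auto simp: energy_def)
qed (auto intro!: linearI simp: energy_def blinfun.add_left blinfun.add_right
    blinfun.scaleR_left blinfun.scaleR_right field_simps)

text \<open>Adding multiples of \<open>f \<in> A 0\<close> to an image \<open>a'\<close> keeps \<open>a' a\<close> nonnegative, so \<open>f a\<close> vanishes.\<close>

lemma image_zero_subset: "A 0 \<subseteq> annihilator (dom A)"
proof
  fix f assume f: "f \<in> A 0"
  have "f a = 0" if a: "a \<in> dom A" for a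
  proof -
    obtain a' where a': "(a, a') \<in> gra A" using a by (rule domE)
    have "0 * t\<^sup>2 + 2 * (f a / 2) * t + a' a \<ge> 0" for t
    proof -
      have "(0, f) \<in> gra A" using f by (simp add: mem_gra)
      then have "(a + t *\<^sub>R 0, a' + t *\<^sub>R f) \<in> gra A" using a' by (intro add_mem scale_mem)
      then show ?thesis using nonneg by (fastforce simp: blinfun.add_left blinfun.scaleR_left mult.commute)
    qed
    then have "(f a / 2)\<^sup>2 \<le> 0 * (a' a)" by (rule quadratic_nonneg_discriminant) simp
    then show ?thesis by simp
  qed
  then show "f \<in> annihilator (dom A)" by (simp add: annihilator_def)
qed

lemma maximal_imp_image_zero:
  assumes "maximally_monotone A"
  shows "A 0 = annihilator (dom A)"
proof
  show "annihilator (dom A) \<subseteq> A 0"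
  proof
    fix f assume f: "f \<in> annihilator (dom A)"
    have "0 \<le> (a' - f) (a - 0)" if "(a, a') \<in> gra A" for a a'
      using nonneg[OF that] f domI[OF that] by (simp add: annihilator_def blinfun.diff_left)
    then have "(0, f) \<in> gra A" using assms unfolding maximally_monotone_wrt_iff by blast
    then show "f \<in> A 0" by (simp add: mem_gra)
  qed
qed (rule image_zero_subset)

text \<open>A point \<open>(x, x')\<close> related to the graph has \<open>x\<close> in the domain: otherwise a functional that vanishes on
the domain but not at \<open>x\<close> belongs to \<open>A 0\<close>, and a suitable multiple of it violates the relation.
Once \<open>x\<close> is in the domain, \<open>x'\<close> differs from an image of \<open>x\<close> by an element of \<open>A 0\<close>, because the
linear term in \<open>t\<close> has to vanish along the lines through \<open>x\<close>.\<close>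

lemma image_zero_imp_maximal:
  assumes A0: "A 0 = annihilator (dom A)" and closed: "closed (dom A)"
  shows "maximally_monotone A"
  unfolding maximally_monotone_wrt_iff
proof (intro conjI mono ballI impI)
  fix x x' assume "\<forall>a\<in>UNIV. \<forall>a'\<in>UNIV. (a, a') \<in> gra A \<longrightarrow> 0 \<le> (a' - x') (a - x)"
  then have rel: "\<And>a a'. (a, a') \<in> gra A \<Longrightarrow> 0 \<le> (a' - x') (a - x)" by blast
  have "x \<in> dom A"
  proof (rule ccontr)
    assume "x \<notin> dom A"
    then obtain f where f: "f \<in> annihilator (dom A)" "f x = 1"
      using annihilator_separates[OF subspace_dom closed] by blast
    then have "(0, f) \<in> gra A" using A0 by (simp add: mem_gra)
    \<comment> \<open>The factor is chosen such that the right-hand side is \<open>- 1\<close>.\<close>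
    then have "0 \<le> ((x' x + 1) *\<^sub>R f - x') (0 - x)"
      using scale_mem[of 0 f "x' x + 1"] rel by fastforce
    then show False using f(2)
      by (simp add: blinfun.diff_left blinfun.diff_right blinfun.scaleR_left blinfun.minus_right)
  qed
  then obtain y where y: "(x, y) \<in> gra A" by (rule domE)
  have "(x' - y) a = 0" if a: "a \<in> dom A" for a
  proof -
    obtain a' where a': "(a, a') \<in> gra A" using a by (rule domE)
    have "a' a * t\<^sup>2 + 2 * ((y - x') a / 2) * t + 0 \<ge> 0" for t
    proof -
      have "0 \<le> (y + t *\<^sub>R a' - x') (x + t *\<^sub>R a - x)"
        by (intro rel add_mem scale_mem a' y)
      also have "\<dots> = a' a * t\<^sup>2 + (y - x') a * t"
        by (simp add: blinfun.add_left blinfun.diff_left blinfun.scaleR_left blinfun.scaleR_right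
            power2_eq_square algebra_simps)
      finally show ?thesis by simp
    qed
    then have "((y - x') a / 2)\<^sup>2 \<le> (a' a) * 0"
      by (rule quadratic_nonneg_discriminant) (rule nonneg[OF a'])
    then have "(y - x') a = 0" by simp
    then show ?thesis by (simp add: blinfun.diff_left)
  qed
  then have "(0, x' - y) \<in> gra A" using A0 by (simp add: mem_gra annihilator_def)
  then show "(x, x') \<in> gra A" using add_mem[OF y] by fastforce
qed

end

text \<open>If (NI) fails at \<open>(x'', x')\<close>, then \<open>\<langle>a - x'', a' - x'\<rangle>\<close> is bounded below by some \<open>\<delta> > 0\<close> on the
graph. Along the net provided by type (D) the first factor stays bounded and the second one tends
to zero in norm.\<close>

lemma type_D_imp_type_NI:
  assumes D: "type_D A"
  shows "type_NI A"
proof (rule ccontr)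
  assume "\<not> type_NI A"
  then obtain x'' :: "'a bidual" and x' :: "'a dual" where
    "(SUP (a, a') \<in> gra A. ereal (x' a + x'' a' - a' a)) < ereal (x'' x')"
    unfolding type_NI_def by (auto simp: not_le)
  from ereal_dense2[OF this]
  obtain r where r: "(SUP (a, a') \<in> gra A. ereal (x' a + x'' a' - a' a)) < ereal r" "r < x'' x'"
    by auto
  define \<delta> where "\<delta> = x'' x' - r"
  have "\<delta> > 0" using r(2) by (simp add: \<delta>_def)
  have gap: "\<delta> \<le> (canon a - x'') (a' - x')" if "(a, a') \<in> gra A" for a a'
  proof -
    have "ereal (x' a + x'' a' - a' a) \<le> (SUP (a, a') \<in> gra A. ereal (x' a + x'' a' - a' a))"
      using that by (intro SUP_upper2[of "(a, a')"]) auto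
    from le_less_trans[OF this r(1)] have "x' a + x'' a' - a' a < r" by simp
    then show ?thesis by (simp add: \<delta>_def blinfun.diff_left blinfun.diff_right)
  qed
  have "(INF (a, a') \<in> gra A. ereal ((canon a - x'') (a' - x'))) \<ge> 0"
    using gap \<open>\<delta> > 0\<close> by (intro INF_greatest) (force simp: zero_ereal_def)
  then obtain I :: "(('a \<times> 'a dual) \<times> ('a \<times> 'a dual) set) set" and le a a' where net:
    "directed_set I le" "\<And>i. i \<in> I \<Longrightarrow> (a i, a' i) \<in> gra A"
    "bounded ((\<lambda>i. (a i, a' i)) ` I)" "(a' \<longlongrightarrow> x') (tails I le)"
    using D unfolding type_D_def by blast
  obtain M where M: "\<And>i. i \<in> I \<Longrightarrow> norm (a i, a' i) \<le> M"
    using net(3) unfolding bounded_iff by blast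
  define R where "R = \<bar>M\<bar> + norm x'' + 1"
  have "R > 0" by (simp add: R_def add_nonneg_pos)
  have "eventually (\<lambda>i. dist (a' i) x' < \<delta> / R) (tails I le)"
    using net(4) \<open>\<delta> > 0\<close> \<open>R > 0\<close> by (intro tendstoD) auto
  then obtain i where i: "i \<in> I" "norm (a' i - x') < \<delta> / R"
    unfolding eventually_tails[OF net(1)] dist_norm using net(1) unfolding directed_set_def by blast
  have "norm (canon (a i) - x'') \<le> R"
  proof -
    have "norm (canon (a i)) \<le> norm (a i)" by (rule norm_canon_le)
    also have "\<dots> \<le> M" using M[OF i(1)] norm_fst_le order_trans by blast
    finally show ?thesis using norm_triangle_ineq4[of "canon (a i)" x''] unfolding R_def by linarith
  qed
  then have "\<bar>(canon (a i) - x'') (a' i - x')\<bar> \<le> R * norm (a' i - x')"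
    using norm_blinfun[of "canon (a i) - x''" "a' i - x'"]
      mult_right_mono[of "norm (canon (a i) - x'')" R "norm (a' i - x')"] by simp
  also have "\<dots> < \<delta>" using i(2) \<open>R > 0\<close> by (simp add: field_simps)
  finally show False using gap[OF net(2)[OF i(1)]] by linarith
qed

context monotone_linear_relation
begin

lemma type_NI_imp_adjoint_monotone:
  assumes "type_NI A"
  shows "bidual_monotone (adjoint_rel A)"
  unfolding bidual_monotone_adjoint_iff
proof (intro allI impI)
  fix z z' assume z: "(z, z') \<in> gra (adjoint_rel A)"
  have "ereal ((- z) z') \<le> (SUP (a, a') \<in> gra A. ereal (z' a + (- z) a' - a' a))"
    using assms unfolding type_NI_def by blast
  also have "\<dots> \<le> 0"
    using z nonneg by (intro SUP_least) (auto simp: mem_gra_adjoint blinfun.minus_left zero_ereal_def)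
  finally show "0 \<le> z z'" by (simp add: blinfun.minus_left)
qed

text \<open>Suppose \<open>z z' < 0\<close>. For \<open>b'\<close> in the half space \<open>V\<close> where \<open>z\<close> is negative,
\<open>(b' - z') b = b' b - z b' \<ge> 0\<close>. So \<open>(0, z')\<close> is related to the part of the graph over \<open>V\<close>, and
type (FP) puts it into the graph, where the definition of the adjoint gives \<open>z z' = z' 0 = 0\<close>.\<close>

lemma type_FP_imp_adjoint_monotone:
  assumes max: "maximally_monotone A" and FP: "type_FP A"
  shows "bidual_monotone (adjoint_rel A)"
  unfolding bidual_monotone_adjoint_iff
proof (intro allI impI, rule ccontr)
  fix z z' assume z: "(z, z') \<in> gra (adjoint_rel A)" and neg: "\<not> 0 \<le> z z'"
  define V where "V = {v. z v < 0}"
  have "open V" unfolding V_def by (intro open_Collect_less continuous_intros)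
  have "convex V" unfolding V_def
  proof (rule convexI, clarsimp simp: blinfun.add_right blinfun.scaleR_right)
    fix x y and u v :: real assume "z x < 0" "z y < 0" "0 \<le> u" "0 \<le> v" "u + v = 1"
    then show "u * z x + v * z y < 0"
      by (smt (verit) mult_nonneg_nonpos mult_pos_neg)
  qed
  have z_not_image: "(0, z') \<notin> gra A"
  proof
    assume "(0, z') \<in> gra A"
    then have "z' 0 = z z'" using z unfolding mem_gra_adjoint by blast
    then show False using neg by (simp add: blinfun.zero_right)
  qed
  \<comment> \<open>If \<open>z\<close> vanished on the range, then \<open>z'\<close> would annihilate the domain and \<open>(0, z')\<close> would be in the graph.\<close>
  have "\<exists>a a'. (a, a') \<in> gra A \<and> z a' \<noteq> 0"
  proof (rule ccontr)
    assume "\<not> ?thesis"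
    then have "z' \<in> annihilator (dom A)"
      using z by (auto simp: mem_gra_adjoint annihilator_def elim!: domE)
    then show False using maximal_imp_image_zero[OF max] z_not_image by (simp add: mem_gra)
  qed
  then obtain a a' where a: "(a, a') \<in> gra A" "z a' \<noteq> 0" by blast
  have "((- z a') *\<^sub>R a, (- z a') *\<^sub>R a') \<in> gra A" using a(1) by (rule scale_mem)
  moreover have "z a' * z a' > 0" using a(2) not_real_square_gt_zero by blast
  moreover from this have "(- z a') *\<^sub>R a' \<in> V"
    by (simp add: V_def blinfun.scaleR_right blinfun.minus_right)
  ultimately have "V \<inter> ran A \<noteq> {}" by (auto simp: ran_def mem_gra)
  then have "maximally_monotone_wrt A UNIV V"
    using FP \<open>open V\<close> \<open>convex V\<close> unfolding type_FP_def by blast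
  moreover have "0 \<le> (b' - z') (b - 0)" if "(b, b') \<in> gra A" "b' \<in> V" for b b'
  proof -
    have "z' b = z b'" using z that(1) unfolding mem_gra_adjoint by blast
    then show ?thesis using that(2) nonneg[OF that(1)] by (simp add: V_def blinfun.diff_left)
  qed
  moreover have "z' \<in> V" using neg by (simp add: V_def)
  ultimately have "(0, z') \<in> gra A" unfolding maximally_monotone_wrt_iff by blast
  then show False using z_not_image by blast
qed

end

section \<open>Closed graph and closed domain\<close>

locale closed_domain_relation = monotone_linear_relation A
  for A :: "'a::banach \<Rightarrow> 'a dual set" +
  assumes closed_gra: "closed (gra A)" and closed_dom: "closed (dom A)"
begin

lemma bounded_selection:
  "\<exists>C\<ge>0. \<forall>x\<in>dom A. \<exists>a'. (x, a') \<in> gra A \<and> norm a' \<le> C * norm x"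
  by (rule closed_relation_bounded[OF subspace_gra closed_gra closed_dom[folded fst_gra]])
    (auto simp: fst_gra)

text \<open>On the graph \<open>z a'\<close> depends only on \<open>a\<close>, as \<open>z\<close> vanishes on \<open>A 0\<close>, and it is bounded by a multiple of
\<open>norm a\<close>, as \<open>a'\<close> can be replaced by an image of small norm. A Hahn--Banach extension of this
functional is an image of \<open>z\<close> under the adjoint.\<close>

lemma adjoint_domain:
  fixes z :: "'a bidual"
  assumes z: "\<And>f. f \<in> A 0 \<Longrightarrow> z f = 0"
  obtains z' where "(z, z') \<in> gra (adjoint_rel A)"
proof -
  obtain C where C: "C \<ge> 0" "\<And>x. x \<in> dom A \<Longrightarrow> \<exists>a'. (x, a') \<in> gra A \<and> norm a' \<le> C * norm x"
    using bounded_selection by blast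
  have "z (snd g) \<le> (norm z * C) * norm (fst g)" if g: "g \<in> gra A" for g
  proof -
    obtain a a' where aa': "g = (a, a')" "(a, a') \<in> gra A" using g by (cases g) auto
    obtain b' where b': "(a, b') \<in> gra A" "norm b' \<le> C * norm a" using C(2) domI[OF aa'(2)] by blast
    have "a' - b' \<in> A 0" using diff_mem[OF aa'(2) b'(1)] by (simp add: mem_gra)
    then have "z (a' - b') = 0" by (rule z)
    then have "z a' = z b'" by (simp add: blinfun.diff_right)
    also have "\<dots> \<le> norm z * norm b'" using norm_blinfun[of z b'] by simp
    also have "\<dots> \<le> norm z * (C * norm a)" using b'(2) by (intro mult_left_mono) auto
    finally show ?thesis using aa'(1) by simp
  qed
  moreover have "linear (\<lambda>g::'a \<times> 'a dual. z (snd g))"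
    by (auto simp: linear_iff blinfun.add_right blinfun.scaleR_right)
  moreover have "norm z * C \<ge> 0" using C(1) by simp
  ultimately obtain f :: "'a dual" where "\<And>g. g \<in> gra A \<Longrightarrow> f (fst g) = z (snd g)"
    using functional_on_domain[OF subspace_gra, of "\<lambda>g. z (snd g)" "norm z * C"] by blast
  then show thesis using that[of f] by (fastforce simp: mem_gra_adjoint)
qed

lemma energy_bound:
  "\<exists>C\<ge>0. \<forall>a a'. (a, a') \<in> gra A \<longrightarrow> a' a \<le> C * (norm a)\<^sup>2"
proof -
  obtain C where C: "C \<ge> 0" "\<And>x. x \<in> dom A \<Longrightarrow> \<exists>a'. (x, a') \<in> gra A \<and> norm a' \<le> C * norm x"
    using bounded_selection by blast
  have "a' a \<le> C * (norm a)\<^sup>2" if a: "(a, a') \<in> gra A" for a a'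
  proof -
    obtain b' where b': "(a, b') \<in> gra A" "norm b' \<le> C * norm a" using C(2) domI[OF a] by blast
    have "a' - b' \<in> A 0" using diff_mem[OF a b'(1)] by (simp add: mem_gra)
    then have "a' a = b' a"
      using image_zero_subset domI[OF a] by (auto simp: annihilator_def blinfun.diff_left)
    also have "\<dots> \<le> norm b' * norm a" using norm_blinfun[of b' a] by simp
    also have "\<dots> \<le> C * norm a * norm a" using b'(2) by (intro mult_right_mono) auto
    finally show ?thesis by (simp add: power2_eq_square)
  qed
  then show ?thesis using C(1) by blast
qed

text \<open>The error of the approximate Riesz representation is bounded by the root of the energy, thus by a
multiple of \<open>norm a\<close>, and becomes a genuine functional \<open>e\<close> on the space. There is no bound on
\<open>norm b\<close> uniform in \<open>\<epsilon>\<close>. This is why smallness of \<open>e b\<close> is recorded separately; it comes from the bound on the energy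
of \<open>(b, b')\<close>.\<close>

lemma approximate_representation:
  assumes L: "linear L" "\<And>g. g \<in> gra A \<Longrightarrow> (L g)\<^sup>2 \<le> M * energy g g" and M: "M \<ge> 0"
  obtains K where "K \<ge> 0" "\<And>\<epsilon>. 0 < \<epsilon> \<Longrightarrow> \<epsilon> \<le> 1 \<Longrightarrow>
    \<exists>b b' e. (b, b') \<in> gra A \<and> norm e \<le> \<epsilon> * K \<and> \<bar>blinfun_apply e b\<bar> \<le> \<epsilon> * K \<and>
      (\<forall>a a'. (a, a') \<in> gra A \<longrightarrow> L (a, a') = (a' b + b' a) / 2 + blinfun_apply e a)"
proof -
  obtain C where C: "C \<ge> 0" "\<And>a a'. (a, a') \<in> gra A \<Longrightarrow> a' a \<le> C * (norm a)\<^sup>2"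
    using energy_bound by blast
  define K where "K = sqrt C + sqrt M + 1"
  have K: "sqrt C \<le> K" "sqrt M + 1 \<le> K" "K \<ge> 0" using C(1) M by (auto simp: K_def)
  have "\<exists>b b' e. (b, b') \<in> gra A \<and> norm e \<le> \<epsilon> * K \<and> \<bar>blinfun_apply e b\<bar> \<le> \<epsilon> * K \<and>
      (\<forall>a a'. (a, a') \<in> gra A \<longrightarrow> L (a, a') = (a' b + b' a) / 2 + blinfun_apply e a)"
    if \<epsilon>: "0 < \<epsilon>" "\<epsilon> \<le> 1" for \<epsilon>
  proof -
    obtain f where f: "f \<in> gra A" "\<And>g. g \<in> gra A \<Longrightarrow> \<bar>L g - energy f g\<bar> \<le> \<epsilon> * sqrt (energy g g)"
      "sqrt (energy f f) \<le> sqrt M + \<epsilon>"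
      using energy.approximate_riesz[OF L \<epsilon>(1) M] by blast
    have "L g - energy f g \<le> (\<epsilon> * sqrt C) * norm (fst g)" if g: "g \<in> gra A" for g
    proof -
      have "energy g g \<le> C * (norm (fst g))\<^sup>2"
        using C(2)[of "fst g" "snd g"] g by (simp add: energy_def)
      then have "sqrt (energy g g) \<le> sqrt C * norm (fst g)"
        using real_sqrt_le_mono by (fastforce simp: real_sqrt_mult)
      then have "\<epsilon> * sqrt (energy g g) \<le> \<epsilon> * (sqrt C * norm (fst g))"
        using \<epsilon>(1) by (intro mult_left_mono) auto
      then show ?thesis using f(2)[OF g] by simp
    qed
    moreover have "linear (\<lambda>g. L g - energy f g)"
      using L(1) energy.linear_right[of f] by (simp add: linear_compose_sub)
    moreover have "\<epsilon> * sqrt C \<ge> 0" using \<epsilon>(1) C(1) by simp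
    ultimately obtain e :: "'a dual"
      where e: "\<And>g. g \<in> gra A \<Longrightarrow> e (fst g) = L g - energy f g" "norm e \<le> \<epsilon> * sqrt C"
      using functional_on_domain[OF subspace_gra, of "\<lambda>g. L g - energy f g" "\<epsilon> * sqrt C"] by blast
    have "norm e \<le> \<epsilon> * K"
      using e(2) mult_left_mono[OF K(1) less_imp_le[OF \<epsilon>(1)]] by (rule order_trans)
    moreover have "\<bar>e (fst f)\<bar> \<le> \<epsilon> * K"
    proof -
      have "\<bar>e (fst f)\<bar> \<le> \<epsilon> * sqrt (energy f f)" using e(1) f(1,2) by simp
      also have "\<dots> \<le> \<epsilon> * K" using f(3) \<epsilon> K(2) by (intro mult_left_mono) auto
      finally show ?thesis .
    qed
    moreover have "L (a, a') = (a' (fst f) + snd f a) / 2 + e a" if "(a, a') \<in> gra A" for a a'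
      using e(1)[OF that] by (simp add: energy_def)
    ultimately show ?thesis using f(1) by (intro exI[of _ "fst f"] exI[of _ "snd f"] exI[of _ e]) auto
  qed
  then show thesis using that K(3) by blast
qed

text \<open>A functional \<open>f\<close> that annihilates the domain without lying in the closed subspace \<open>A 0\<close> is separated
from it by some \<open>z\<close>. Then \<open>z\<close> is in the domain of the adjoint, and since \<open>f\<close> is in the image of \<open>0\<close>
under the adjoint, the images of \<open>z\<close> can be shifted by multiples of \<open>f\<close> to make the pairing with \<open>z\<close> negative.\<close>

lemma adjoint_monotone_imp_image_zero:
  assumes "bidual_monotone (adjoint_rel A)"
  shows "A 0 = annihilator (dom A)"
proof (rule antisym[OF image_zero_subset], rule subsetI, rule ccontr)
  fix f assume f: "f \<in> annihilator (dom A)" "f \<notin> A 0"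
  have A0: "A 0 = (\<lambda>f. (0, f)) -` gra A" by (auto simp: mem_gra)
  have "closed (A 0)" unfolding A0
    by (intro closed_vimage closed_gra continuous_intros)
  moreover have "subspace (A 0)" unfolding A0
    by (intro linear_subspace_vimage subspace_gra) (auto simp: linear_iff)
  ultimately obtain z where z: "z \<in> annihilator (A 0)" "z f = 1"
    using annihilator_separates f(2) by blast
  then obtain z' where z': "(z, z') \<in> gra (adjoint_rel A)"
    using adjoint_domain[of z] by (auto simp: annihilator_def)
  have "(0, f) \<in> gra (adjoint_rel A)" using f(1) by (simp add: mem_gra adjoint_rel_zero)
  then have "(z, z') - (z z' + 1) *\<^sub>R (0, f) \<in> gra (adjoint_rel A)"
    using z' by (intro subspace_diff subspace_scale subspace_gra_adjoint)
  then have "(z, z' - (z z' + 1) *\<^sub>R f) \<in> gra (adjoint_rel A)" by simp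
  then have "0 \<le> z (z' - (z z' + 1) *\<^sub>R f)"
    using assms unfolding bidual_monotone_adjoint_iff by blast
  then show False using z(2) by (simp add: blinfun.diff_right blinfun.scaleR_right)
qed

lemma adjoint_monotone_imp_maximal:
  "bidual_monotone (adjoint_rel A) \<Longrightarrow> maximally_monotone A"
  using adjoint_monotone_imp_image_zero image_zero_imp_maximal closed_dom by blast

text \<open>Along the line spanned by \<open>(a, a')\<close> the relation is a nonnegative quadratic polynomial; this is its
discriminant inequality.\<close>

lemma related_imp_discriminant:
  fixes x'' :: "'a bidual" and x' :: "'a dual"
  assumes rel: "\<And>a a'. (a, a') \<in> gra A \<Longrightarrow> 0 \<le> (canon a - x'') (a' - x')"
    and a: "(a, a') \<in> gra A"
  shows "((x' a + x'' a') / 2)\<^sup>2 \<le> x'' x' * energy (a, a') (a, a')"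
proof -
  define \<beta> where "\<beta> = (- x' a - x'' a') / 2"
  have \<beta>: "2 * \<beta> = - x' a - x'' a'" by (simp add: \<beta>_def)
  have "a' a * t\<^sup>2 + 2 * \<beta> * t + x'' x' \<ge> 0" for t
  proof -
    have "0 \<le> (canon (t *\<^sub>R a) - x'') (t *\<^sub>R a' - x')" using a by (intro rel scale_mem)
    also have "\<dots> = a' a * t\<^sup>2 + (- x' a - x'' a') * t + x'' x'"
      by (simp add: blinfun.diff_left blinfun.diff_right blinfun.scaleR_left blinfun.scaleR_right
          power2_eq_square algebra_simps)
    finally show ?thesis by (simp only: \<beta>)
  qed
  then have "\<beta>\<^sup>2 \<le> (a' a) * x'' x'"
    by (rule quadratic_nonneg_discriminant) (rule nonneg[OF a])
  moreover have "\<beta>\<^sup>2 = ((x' a + x'' a') / 2)\<^sup>2"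
    by (simp add: \<beta>_def power2_eq_square algebra_simps)
  ultimately show ?thesis by (simp add: energy_def mult.commute)
qed

text \<open>The key step. The point \<open>(v, v')\<close> built from the approximate representation lies in the graph of
the adjoint and approximates \<open>(x'' - b, b' - x')\<close>. Its energy is an error term minus the pairing
\<open>\<langle>b - x'', b' - x'\<rangle>\<close>, which is nonnegative by hypothesis; since the adjoint is monotone, the energy is
small. By the Cauchy--Schwarz inequality the energy product with \<open>(w, w')\<close> is small. In this product
the terms with \<open>b\<close> and \<open>b'\<close> cancel.\<close>

lemma related_imp_adjoint_symmetric:
  fixes x'' :: "'a bidual" and x' :: "'a dual"
  assumes mon: "bidual_monotone (adjoint_rel A)"
    and rel: "\<And>a a'. (a, a') \<in> gra A \<Longrightarrow> 0 \<le> (canon a - x'') (a' - x')"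
    and w: "(w, w') \<in> gra (adjoint_rel A)"
  shows "x'' w' = w x'"
proof -
  interpret dual: psd_form "gra (adjoint_rel A)" dual_energy
    by (rule psd_form_dual_energy[OF mon])
  define L where "L g = (x' (fst g) + x'' (snd g)) / 2" for g :: "'a \<times> 'a dual"
  have "linear L"
    by (auto simp: L_def linear_iff blinfun.add_right blinfun.scaleR_right field_simps)
  moreover have "(L g)\<^sup>2 \<le> x'' x' * energy g g" if g: "g \<in> gra A" for g
    using related_imp_discriminant[OF rel, of "fst g" "snd g"] g by (simp add: L_def)
  moreover have "0 \<le> x'' x'" using rel[OF zero_mem] by (simp add: blinfun.minus_left blinfun.minus_right)
  ultimately obtain K where K: "K \<ge> 0" "\<And>\<epsilon>. 0 < \<epsilon> \<Longrightarrow> \<epsilon> \<le> 1 \<Longrightarrow>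
    \<exists>b b' e. (b, b') \<in> gra A \<and> norm e \<le> \<epsilon> * K \<and> \<bar>blinfun_apply e b\<bar> \<le> \<epsilon> * K \<and>
      (\<forall>a a'. (a, a') \<in> gra A \<longrightarrow> L (a, a') = (a' b + b' a) / 2 + blinfun_apply e a)"
    using approximate_representation by blast
  define c where "c = w w' * (2 * (norm x'' * K + K))"
  have "\<bar>x'' w' - w x'\<bar> \<le> (2 * norm w * K) * \<epsilon> + 2 * sqrt (c * \<epsilon>)" if \<epsilon>: "0 < \<epsilon>" "\<epsilon> \<le> 1" for \<epsilon>
  proof -
    obtain b b' e where b: "(b, b') \<in> gra A" "norm e \<le> \<epsilon> * K" "\<bar>blinfun_apply e b\<bar> \<le> \<epsilon> * K"
      "\<And>a a'. (a, a') \<in> gra A \<Longrightarrow> L (a, a') = (a' b + b' a) / 2 + blinfun_apply e a"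
      using K(2)[OF \<epsilon>] by blast
    define v where "v = x'' - canon b"
    define v' where "v' = b' - x' + 2 *\<^sub>R e"
    have "v' a = v a'" if "(a, a') \<in> gra A" for a a'
      using b(4)[OF that] unfolding L_def
      by (simp add: field_simps v_def v'_def blinfun.diff_left blinfun.add_left blinfun.scaleR_left)
    then have v: "(v, v') \<in> gra (adjoint_rel A)" by (simp add: mem_gra_adjoint)
    have "v v' = - ((canon b - x'') (b' - x')) + 2 * x'' e - 2 * e b"
      by (simp add: v_def v'_def blinfun.diff_left blinfun.diff_right blinfun.add_left blinfun.add_right
          blinfun.scaleR_left blinfun.scaleR_right algebra_simps)
    also have "\<dots> \<le> 2 * (norm x'' * (\<epsilon> * K)) + 2 * (\<epsilon> * K)"
    proof -
      have "x'' e \<le> norm x'' * norm e" using norm_blinfun[of x'' e] by simp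
      also have "\<dots> \<le> norm x'' * (\<epsilon> * K)" using b(2) by (intro mult_left_mono) auto
      finally show ?thesis using rel[OF b(1)] b(3) by linarith
    qed
    finally have vv: "v v' \<le> 2 * (norm x'' * K + K) * \<epsilon>" by (simp add: algebra_simps)
    have "(dual_energy (v, v') (w, w'))\<^sup>2 \<le> dual_energy (w, w') (w, w') * dual_energy (v, v') (v, v')"
      using v w by (rule dual.cauchy_schwarz)
    also have "\<dots> = w w' * v v'" by (simp add: dual_energy_def)
    also have "\<dots> \<le> w w' * (2 * (norm x'' * K + K) * \<epsilon>)"
      using vv mon w unfolding bidual_monotone_adjoint_iff by (intro mult_left_mono) auto
    finally have "(dual_energy (v, v') (w, w'))\<^sup>2 \<le> c * \<epsilon>" by (simp add: c_def mult.assoc)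
    then have "\<bar>dual_energy (v, v') (w, w')\<bar> \<le> sqrt (c * \<epsilon>)"
      using real_sqrt_le_mono by fastforce
    moreover have "2 * dual_energy (v, v') (w, w') = x'' w' - w x' + 2 * w e"
    proof -
      have "w' b = w b'" using w b(1) unfolding mem_gra_adjoint by blast
      then show ?thesis
        by (simp add: dual_energy_def v_def v'_def blinfun.diff_left blinfun.diff_right
            blinfun.add_right blinfun.scaleR_right)
    qed
    moreover have "\<bar>w e\<bar> \<le> norm w * (\<epsilon> * K)"
      using norm_blinfun[of w e] mult_left_mono[OF b(2), of "norm w"] by simp
    ultimately have "\<bar>x'' w' - w x'\<bar> \<le> 2 * sqrt (c * \<epsilon>) + 2 * (norm w * (\<epsilon> * K))" by linarith
    then show ?thesis by (simp add: algebra_simps)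
  qed
  then have "\<bar>x'' w' - w x'\<bar> \<le> 0" by (rule le_sqrt_error_imp_le_zero)
  then show ?thesis by simp
qed

text \<open>The argument for the maximality of \<open>A\<close> is repeated in the bidual. Here \<open>adjoint_domain\<close> decides
whether a point is in the domain, and testing against the canonical images of the domain of \<open>A\<close>
shows that the second component is correct up to \<open>A* 0\<close>.\<close>

lemma adjoint_monotone_imp_bidual_maximal:
  assumes mon: "bidual_monotone (adjoint_rel A)"
  shows "bidual_maximally_monotone (adjoint_rel A)"
  unfolding bidual_maximally_monotone_def
proof (intro conjI mon notI, elim exE conjE)
  fix S assume S: "bidual_monotone_set S" "gra (adjoint_rel A) \<subset> S"
  note A0 = adjoint_monotone_imp_image_zero[OF mon]
  obtain x'' x' where x: "(x'', x') \<in> S" "(x'', x') \<notin> gra (adjoint_rel A)" using S(2) by auto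
  have rel: "0 \<le> (w - x'') (w' - x')" if "(w, w') \<in> gra (adjoint_rel A)" for w w'
    using S x(1) that unfolding bidual_monotone_set_def by blast
  have "x'' f = 0" if f: "f \<in> A 0" for f
  proof (rule ccontr)
    assume nz: "x'' f \<noteq> 0"
    \<comment> \<open>With this factor the pairing with \<open>(0, t f)\<close> is \<open>- 1\<close>.\<close>
    define t where "t = (x'' x' + 1) / x'' f"
    have "(0, f) \<in> gra (adjoint_rel A)" using f A0 by (simp add: mem_gra adjoint_rel_zero)
    then have "t *\<^sub>R (0, f) \<in> gra (adjoint_rel A)" by (rule subspace_scale[OF subspace_gra_adjoint])
    then have "0 \<le> (0 - x'') (t *\<^sub>R f - x')" by (intro rel) simp
    then show False using nz by (simp add: t_def blinfun.minus_left blinfun.diff_right blinfun.scaleR_right)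
  qed
  then obtain y' where y': "(x'', y') \<in> gra (adjoint_rel A)" by (rule adjoint_domain)
  have perp: "w (x' - y') = 0" if w: "(w, w') \<in> gra (adjoint_rel A)" for w w'
  proof -
    have "w w' * t\<^sup>2 + 2 * (w (y' - x') / 2) * t + 0 \<ge> 0" for t
    proof -
      have "(x'', y') + t *\<^sub>R (w, w') \<in> gra (adjoint_rel A)"
        using y' w by (intro subspace_add subspace_scale subspace_gra_adjoint)
      then have "0 \<le> (x'' + t *\<^sub>R w - x'') (y' + t *\<^sub>R w' - x')" by (intro rel) simp
      also have "\<dots> = w w' * t\<^sup>2 + w (y' - x') * t"
        by (simp add: blinfun.add_right blinfun.diff_right blinfun.scaleR_left blinfun.scaleR_right
            power2_eq_square algebra_simps)
      finally show ?thesis by simp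
    qed
    then have "(w (y' - x') / 2)\<^sup>2 \<le> w w' * 0"
      using mon w unfolding bidual_monotone_adjoint_iff by (intro quadratic_nonneg_discriminant) auto
    then show ?thesis by (simp add: blinfun.diff_right)
  qed
  have "(x' - y') a = 0" if a: "a \<in> dom A" for a
  proof -
    have "canon a f = 0" if "f \<in> A 0" for f using a that A0 by (auto simp: annihilator_def)
    then obtain w' where "(canon a, w') \<in> gra (adjoint_rel A)" by (rule adjoint_domain)
    then show ?thesis using perp by fastforce
  qed
  then have "(0, x' - y') \<in> gra (adjoint_rel A)"
    by (simp add: mem_gra adjoint_rel_zero annihilator_def)
  with y' have "(x'', y') + (0, x' - y') \<in> gra (adjoint_rel A)"
    by (intro subspace_add subspace_gra_adjoint)
  then show False using x(2) by simp
qed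

end

section \<open>Bounded nets and type (D)\<close>

lemma limitin_weak_star:
  assumes "\<And>f. ((\<lambda>i. blinfun_apply (g i) f) \<longlongrightarrow> blinfun_apply l f) F"
  shows "limitin weak_star_topology g l F"
proof -
  have "limitin (product_topology (\<lambda>_. euclidean) UNIV) (\<lambda>i. blinfun_apply (g i)) (blinfun_apply l) F"
    using assms by (subst limitin_componentwise) auto
  then have lim: "limitin euclidean (\<lambda>i. blinfun_apply (g i)) (blinfun_apply l) F"
    by (simp add: euclidean_product_topology)
  show ?thesis
    unfolding limitin_def strong_operator_topology_topspace
  proof (intro conjI allI impI)
    fix U assume "openin weak_star_topology U \<and> l \<in> U"
    then obtain W where "openin euclidean W" "U = blinfun_apply -` W" "l \<in> U"
      unfolding strong_operator_topology_def openin_pullback_topology by auto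
    then show "\<forall>\<^sub>F i in F. g i \<in> U" using limitinD[OF lim, of W] by simp
  qed simp
qed

context closed_domain_relation
begin

lemma related_imp_biannihilator:
  fixes x'' :: "'a bidual" and x' :: "'a dual"
  assumes A0: "A 0 = annihilator (dom A)"
    and rel: "\<And>a a'. (a, a') \<in> gra A \<Longrightarrow> 0 \<le> (canon a - x'') (a' - x')"
    and f: "f \<in> annihilator (dom A)"
  shows "x'' f = 0"
proof (rule ccontr)
  assume nz: "x'' f \<noteq> 0"
  define t where "t = (x'' x' + 1) / x'' f"
  have "(0, f) \<in> gra A" using f A0 by (simp add: mem_gra)
  then have "0 \<le> (canon (t *\<^sub>R 0) - x'') (t *\<^sub>R f - x')" by (intro rel scale_mem)
  then show False
    using nz by (simp add: t_def blinfun.minus_left blinfun.diff_right blinfun.scaleR_right)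
qed

text \<open>A Goldstine theorem for the graph. If the approximation fails, the seminorm
\<open>inf {p v g | g \<in> graph}\<close> is at least \<open>2\<close> at \<open>(x'', x')\<close>, and the Hahn--Banach theorem gives a linear \<open>L\<close>
below it that attains \<open>2\<close> there. Being controlled by finitely many evaluations in the first argument
and by the norm in the second one, \<open>L\<close> is the pairing with some \<open>f0\<close> in the dual and some \<open>w\<close> in the
bidual. As \<open>L\<close> is bounded by \<open>norm a / r\<close> on the graph, \<open>w\<close> has an image \<open>w'\<close> under the adjoint and
\<open>f0 + w'\<close> has norm at most \<open>1 / r\<close> on the domain. The symmetry hypothesis turns \<open>L (x'', x')\<close> into
\<open>x'' (f0 + w') \<le> norm x'' / r < 1\<close>.\<close>

lemma bounded_weak_star_approximation:
  fixes x'' :: "'a bidual" and x' :: "'a dual"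
  assumes A0: "A 0 = annihilator (dom A)"
    and x''0: "\<And>f. f \<in> annihilator (dom A) \<Longrightarrow> x'' f = 0"
    and sym: "\<And>w w'. (w, w') \<in> gra (adjoint_rel A) \<Longrightarrow> x'' w' = w x'"
    and F: "finite F" and \<epsilon>: "\<epsilon> > 0"
  shows "\<exists>a a'. (a, a') \<in> gra A \<and> norm a \<le> 2 * (norm x'' + 1) \<and>
    (\<forall>f\<in>F. \<bar>blinfun_apply f a - x'' f\<bar> \<le> \<epsilon>) \<and> norm (a' - x') \<le> \<epsilon>"
proof -
  define r where "r = norm x'' + 1"
  have r: "r > 0" by (simp add: r_def add_nonneg_pos)
  \<comment> \<open>Below \<open>2\<close>, each of the three nonnegative summands yields one of the required bounds.\<close>
  define p where "p = (\<lambda>(v :: 'a bidual, v' :: 'a dual) (a :: 'a, a' :: 'a dual). norm a / r +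
    2 * (\<Sum>f\<in>F. \<bar>blinfun_apply v f - blinfun_apply f a\<bar>) / \<epsilon> + 2 * norm (v' - a') / \<epsilon>)"
  have p_add: "p (v + w) (g + h) \<le> p v g + p w h" for v w g h
  proof -
    obtain v1 v2 w1 w2 g1 g2 h1 h2 where eq: "v = (v1, v2)" "w = (w1, w2)" "g = (g1, g2)" "h = (h1, h2)"
      by (metis surj_pair)
    have sub: "2 * u / \<epsilon> \<le> 2 * v / \<epsilon> + 2 * w / \<epsilon>" if "u \<le> v + w" for u v w :: real
      using divide_right_mono[of "2 * u" "2 * v + 2 * w" \<epsilon>] that \<epsilon> by (simp add: add_divide_distrib)
    have 1: "norm (g1 + h1) / r \<le> norm g1 / r + norm h1 / r"
      using divide_right_mono[OF norm_triangle_ineq[of g1 h1], of r] r by (simp add: add_divide_distrib)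
    have "(\<Sum>f\<in>F. \<bar>(v1 + w1) f - blinfun_apply f (g1 + h1)\<bar>)
        \<le> (\<Sum>f\<in>F. \<bar>v1 f - blinfun_apply f g1\<bar> + \<bar>w1 f - blinfun_apply f h1\<bar>)"
      by (intro sum_mono) (auto simp: blinfun.add_left blinfun.add_right)
    then have 2: "2 * (\<Sum>f\<in>F. \<bar>(v1 + w1) f - blinfun_apply f (g1 + h1)\<bar>) / \<epsilon> \<le>
        2 * (\<Sum>f\<in>F. \<bar>v1 f - blinfun_apply f g1\<bar>) / \<epsilon> + 2 * (\<Sum>f\<in>F. \<bar>w1 f - blinfun_apply f h1\<bar>) / \<epsilon>"
      by (intro sub) (simp add: sum.distrib)
    have "norm ((v2 + w2) - (g2 + h2)) \<le> norm (v2 - g2) + norm (w2 - h2)"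
      by (rule norm_diff_triangle_ineq)
    then have 3: "2 * norm ((v2 + w2) - (g2 + h2)) / \<epsilon> \<le> 2 * norm (v2 - g2) / \<epsilon> + 2 * norm (w2 - h2) / \<epsilon>"
      by (rule sub)
    show ?thesis using 1 2 3 unfolding eq p_def by simp
  qed
  have p_scale: "p (t *\<^sub>R v) (t *\<^sub>R g) = \<bar>t\<bar> * p v g" for t v g
  proof -
    obtain v1 v2 g1 g2 where eq: "v = (v1, v2)" "g = (g1, g2)" by (metis surj_pair)
    have "\<bar>(t *\<^sub>R v1) f - blinfun_apply f (t *\<^sub>R g1)\<bar> = \<bar>t\<bar> * \<bar>v1 f - blinfun_apply f g1\<bar>" for f
      by (simp add: blinfun.scaleR_left blinfun.scaleR_right flip: right_diff_distrib abs_mult)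
    then have "(\<Sum>f\<in>F. \<bar>(t *\<^sub>R v1) f - blinfun_apply f (t *\<^sub>R g1)\<bar>) = \<bar>t\<bar> * (\<Sum>f\<in>F. \<bar>v1 f - blinfun_apply f g1\<bar>)"
      by (simp add: sum_distrib_left)
    moreover have "norm (t *\<^sub>R v2 - t *\<^sub>R g2) = \<bar>t\<bar> * norm (v2 - g2)"
      by (simp flip: scaleR_diff_right)
    ultimately show ?thesis unfolding eq p_def by (simp add: algebra_simps add_divide_distrib)
  qed
  have p_nonneg: "p v g \<ge> 0" for v g
    using r \<epsilon> unfolding p_def by (cases v; cases g) (auto intro!: add_nonneg_nonneg sum_nonneg)
  have "\<exists>g\<in>gra A. p (x'', x') g < 2"
  proof (rule ccontr)
    assume "\<not> ?thesis"
    then have ge: "p (x'', x') g \<ge> 2" if "g \<in> gra A" for g using that by force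
    define S where "S = {(v, s). \<exists>g\<in>gra A. p v g \<le> s}"
    have SI: "(v, p v g) \<in> S" if "g \<in> gra A" for v g using that by (auto simp: S_def)
    have "convex S"
    proof (rule convexI)
      fix y z and u t :: real assume "y \<in> S" "z \<in> S" and ut: "0 \<le> u" "0 \<le> t"
      then obtain v s g w s' h where *: "y = (v, s)" "g \<in> gra A" "p v g \<le> s"
        "z = (w, s')" "h \<in> gra A" "p w h \<le> s'" by (auto simp: S_def)
      have "u *\<^sub>R g + t *\<^sub>R h \<in> gra A" using * by (intro subspace_add subspace_scale subspace_gra)
      moreover have "p (u *\<^sub>R v + t *\<^sub>R w) (u *\<^sub>R g + t *\<^sub>R h) \<le> u * s + t * s'"
      proof -
        have "p (u *\<^sub>R v + t *\<^sub>R w) (u *\<^sub>R g + t *\<^sub>R h) \<le> u * p v g + t * p w h"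
          using p_add[of "u *\<^sub>R v" "t *\<^sub>R w" "u *\<^sub>R g" "t *\<^sub>R h"] ut by (simp add: p_scale)
        also have "\<dots> \<le> u * s + t * s'" using * ut by (intro add_mono mult_left_mono)
        finally show ?thesis .
      qed
      ultimately show "u *\<^sub>R y + t *\<^sub>R z \<in> S" unfolding *(1,4) S_def by auto
    qed
    moreover have "\<exists>t>0. \<exists>s. (t *\<^sub>R v, s) \<in> S" for v
      using SI[OF zero_mem, of v] by (intro exI[of _ 1] conjI exI[of _ "p v (0, 0)"]) simp_all
    moreover have "q \<le> s" if qs: "(v, q) \<in> span {((x'', x'), 2)}" "(v, s) \<in> S" for v q s
    proof -
      obtain t where t: "v = t *\<^sub>R (x'', x')" "q = t * 2"
        using qs(1) unfolding span_singleton by auto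
      obtain g where g: "g \<in> gra A" "p v g \<le> s" using qs(2) by (auto simp: S_def)
      show ?thesis
      proof (cases "t > 0")
        case True
        have "p (t *\<^sub>R (x'', x')) (t *\<^sub>R ((1 / t) *\<^sub>R g)) = \<bar>t\<bar> * p (x'', x') ((1 / t) *\<^sub>R g)"
          by (rule p_scale)
        then have "p v g = t * p (x'', x') ((1 / t) *\<^sub>R g)" using True t(1) by simp
        moreover have "p (x'', x') ((1 / t) *\<^sub>R g) \<ge> 2"
          using g(1) by (intro ge subspace_scale subspace_gra)
        ultimately have "p v g \<ge> t * 2" using True by simp
        then show ?thesis using g(2) t(2) by simp
      next
        case False
        then show ?thesis using g(2) t(2) p_nonneg[of v g] by linarith
      qed
    qed
    ultimately obtain L where L: "linear L" "\<And>v q. (v, q) \<in> span {((x'', x'), 2)} \<Longrightarrow> L v = q"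
      "\<And>v s. (v, s) \<in> S \<Longrightarrow> L v \<le> s"
      using hahn_banach_epigraph[OF subspace_span[of "{((x'', x'), 2)}"]] by blast
    have Lp: "L v \<le> p v g" if "g \<in> gra A" for v g using L(3) SI[OF that] .
    have Lx: "L (x'', x') = 2" using L(2) span_base by blast
    have "L (v, 0) = 0" if v: "\<forall>f\<in>F. blinfun_apply v f = 0" for v
    proof -
      have "L (v, 0) \<le> 0" "L (- v, 0) \<le> 0"
        using Lp[OF zero_mem, of "(v, 0)"] Lp[OF zero_mem, of "(- v, 0)"] v
        by (simp_all add: p_def blinfun.minus_left)
      moreover have "L (- v, 0) = - L (v, 0)" using linear_neg[OF L(1), of "(v, 0)"] by simp
      ultimately show ?thesis by linarith
    qed
    moreover have "linear (\<lambda>v. L (v, 0))"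
    proof (rule linearI)
      show "L (v + w, 0) = L (v, 0) + L (w, 0)" for v w
        using linear_add[OF L(1), of "(v, 0)" "(w, 0)"] by simp
      show "L (c *\<^sub>R v, 0) = c *\<^sub>R L (v, 0)" for c v
        using linear_scale[OF L(1), of c "(v, 0)"] by simp
    qed
    moreover have "linear (\<lambda>v :: 'a bidual. v f)" for f
      by (simp add: linear_iff blinfun.add_left blinfun.scaleR_left)
    ultimately obtain c where c: "\<And>v. L (v, 0) = (\<Sum>f\<in>F. c f * blinfun_apply v f)"
      using functional_in_span_of_finite[OF F, of "\<lambda>v. L (v, 0)" "\<lambda>f v. blinfun_apply v f"] by blast
    define f0 where "f0 = (\<Sum>f\<in>F. c f *\<^sub>R f)"
    have f0: "L (v, 0) = blinfun_apply v f0" for v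
      unfolding f0_def c by (simp add: blinfun.sum_right blinfun.scaleR_right)
    have "linear (\<lambda>v'. L (0, v'))"
    proof (rule linearI)
      show "L (0, v + w) = L (0, v) + L (0, w)" for v w
        using linear_add[OF L(1), of "(0, v)" "(0, w)"] by simp
      show "L (0, c *\<^sub>R v) = c *\<^sub>R L (0, v)" for c v
        using linear_scale[OF L(1), of c "(0, v)"] by simp
    qed
    moreover have "L (0, v') \<le> (2 / \<epsilon>) * norm v'" for v'
      using Lp[OF zero_mem, of "(0, v')"] by (simp add: p_def)
    ultimately obtain w :: "'a bidual" where w: "blinfun_apply w = (\<lambda>v'. L (0, v'))"
      by (rule linear_bounded_above_imp_blinfun)
    have L_eq: "L (v, v') = blinfun_apply v f0 + w v'" for v v'
      using linear_add[OF L(1), of "(v, 0)" "(0, v')"] by (simp add: f0 w)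
    have graph_le: "f0 a + w a' \<le> norm a / r" if "(a, a') \<in> gra A" for a a'
      using Lp[OF that, of "(canon a, a')"] by (simp add: L_eq p_def)
    have "w f = 0" if "f \<in> A 0" for f
    proof -
      have "(0, f) \<in> gra A" "(0, - f) \<in> gra A"
        using that scale_mem[of 0 f "- 1"] by (simp_all add: mem_gra)
      then show ?thesis using graph_le[of 0 f] graph_le[of 0 "- f"] by (simp add: blinfun.minus_right)
    qed
    then obtain w' where w': "(w, w') \<in> gra (adjoint_rel A)" by (rule adjoint_domain)
    have le: "(f0 + w') a \<le> (1 / r) * norm a" if a: "a \<in> dom A" for a
    proof -
      obtain a' where a': "(a, a') \<in> gra A" using a by (rule domE)
      then have "w' a = w a'" using w' unfolding mem_gra_adjoint by blast
      then show ?thesis using graph_le[OF a'] by (simp add: blinfun.add_left)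
    qed
    have "\<bar>(f0 + w') a\<bar> \<le> (1 / r) * norm a" if "a \<in> dom A" for a
      using le[OF that] le[OF subspace_neg[OF subspace_dom that]] by (simp add: blinfun.minus_right)
    then have "\<bar>x'' (f0 + w')\<bar> \<le> norm x'' * (1 / r)"
      using r by (intro biannihilator_bound[OF subspace_dom x''0]) auto
    also have "\<dots> < 1" using r by (simp add: r_def)
    finally have "x'' f0 + x'' w' < 1" by (simp add: blinfun.add_right)
    then have "L (x'', x') < 1" using sym[OF w'] by (simp add: L_eq)
    then show False using Lx by simp
  qed
  then obtain a a' where a: "(a, a') \<in> gra A" "p (x'', x') (a, a') < 2" by auto
  have nn: "0 \<le> norm a / r" "0 \<le> 2 * (\<Sum>f\<in>F. \<bar>x'' f - blinfun_apply f a\<bar>) / \<epsilon>" "0 \<le> 2 * norm (x' - a') / \<epsilon>"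
    using r \<epsilon> by (auto intro: sum_nonneg)
  have "norm a / r < 2" "2 * (\<Sum>f\<in>F. \<bar>x'' f - blinfun_apply f a\<bar>) / \<epsilon> < 2" "2 * norm (x' - a') / \<epsilon> < 2"
    using a(2) nn unfolding p_def by auto
  then have *: "norm a \<le> 2 * r" "(\<Sum>f\<in>F. \<bar>x'' f - blinfun_apply f a\<bar>) \<le> \<epsilon>" "norm (x' - a') \<le> \<epsilon>"
    using r \<epsilon> by (auto simp: field_simps)
  have "\<bar>blinfun_apply f a - x'' f\<bar> \<le> \<epsilon>" if "f \<in> F" for f
    using member_le_sum[of f F "\<lambda>f. \<bar>x'' f - blinfun_apply f a\<bar>"] that F *(2) by (simp add: abs_minus_commute)
  then show ?thesis using a(1) *(1,3) unfolding r_def by (auto simp: norm_minus_commute)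
qed

text \<open>The approximation lemma makes the sets \<open>N F \<epsilon>\<close> a filter base of nonempty sets, and the net is the one
associated with the filter. The constraint \<open>norm (a' - x') \<le> 1\<close> keeps the second components
bounded for large \<open>\<epsilon>\<close>.\<close>

lemma adjoint_monotone_imp_type_D:
  assumes mon: "bidual_monotone (adjoint_rel A)"
  shows "type_D A"
  unfolding type_D_def
proof (intro allI impI)
  fix x'' :: "'a bidual" and x' :: "'a dual"
  assume inf: "(INF (a, a') \<in> gra A. ereal (blinfun_apply (canon a - x'') (a' - x'))) \<ge> 0"
  have rel: "0 \<le> (canon a - x'') (a' - x')" if "(a, a') \<in> gra A" for a a'
  proof -
    have "(INF (a, a') \<in> gra A. ereal (blinfun_apply (canon a - x'') (a' - x')))
        \<le> ereal ((canon a - x'') (a' - x'))"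
      using that by (intro INF_lower2[of "(a, a')"]) auto
    from order_trans[OF inf this] show ?thesis by (simp add: zero_ereal_def)
  qed
  note A0 = adjoint_monotone_imp_image_zero[OF mon]
  define N where "N F \<epsilon> = {(a, a'). (a, a') \<in> gra A \<and> norm a \<le> 2 * (norm x'' + 1) \<and>
    (\<forall>f\<in>F. \<bar>blinfun_apply f a - x'' f\<bar> \<le> \<epsilon>) \<and> norm (a' - x') \<le> \<epsilon> \<and> norm (a' - x') \<le> 1}" for F \<epsilon>
  have N_ne: "N F \<epsilon> \<noteq> {}" if "finite F" "\<epsilon> > 0" for F \<epsilon>
  proof -
    have "\<exists>a a'. (a, a') \<in> gra A \<and> norm a \<le> 2 * (norm x'' + 1) \<and>
      (\<forall>f\<in>F. \<bar>blinfun_apply f a - x'' f\<bar> \<le> min \<epsilon> 1) \<and> norm (a' - x') \<le> min \<epsilon> 1"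
      using related_imp_biannihilator[OF A0 rel] related_imp_adjoint_symmetric[OF mon rel] that
      by (intro bounded_weak_star_approximation[OF A0]) auto
    then show ?thesis unfolding N_def by fastforce
  qed
  define P where "P = {F :: 'a dual set. finite F} \<times> {\<epsilon>::real. \<epsilon> > 0}"
  define FF where "FF = (INF q\<in>P. principal (N (fst q) (snd q)))"
  have ev: "eventually Q FF \<longleftrightarrow> (\<exists>q\<in>P. \<forall>g\<in>N (fst q) (snd q). Q g)" for Q
    unfolding FF_def
  proof (subst eventually_INF_base)
    show "P \<noteq> {}" by (auto simp: P_def intro!: exI[of _ "{}"] exI[of _ "1::real"])
    fix q q' assume "q \<in> P" "q' \<in> P"
    then show "\<exists>s\<in>P. principal (N (fst s) (snd s)) \<le>
        inf (principal (N (fst q) (snd q))) (principal (N (fst q') (snd q')))"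
      by (intro bexI[of _ "(fst q \<union> fst q', min (snd q) (snd q'))"]) (auto simp: N_def P_def)
  qed (simp add: eventually_principal)
  have "\<not> eventually (\<lambda>_. False) FF" unfolding ev using N_ne by (fastforce simp: P_def)
  then have "FF \<noteq> bot" by (auto simp: trivial_limit_def)
  define S where "S = N {} 1"
  have "({}, 1) \<in> P" by (simp add: P_def)
  then have "FF \<le> principal S" unfolding le_principal ev S_def by (intro bexI[of _ "({}, 1)"]) auto
  then obtain I :: "(('a \<times> 'a dual) \<times> ('a \<times> 'a dual) set) set" and le u
    where net: "directed_set I le" "u ` I \<subseteq> S" "filtermap u (tails I le) = FF"
    by (rule filter_imp_net[OF \<open>FF \<noteq> bot\<close>])
  have ev_net: "eventually (\<lambda>i. u i \<in> N F \<epsilon>) (tails I le)" if "finite F" "\<epsilon> > 0" for F \<epsilon>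
  proof -
    have "(F, \<epsilon>) \<in> P" using that by (simp add: P_def)
    then have "eventually (\<lambda>g. g \<in> N F \<epsilon>) FF" unfolding ev by (intro bexI[of _ "(F, \<epsilon>)"]) auto
    then show ?thesis unfolding net(3)[symmetric] eventually_filtermap .
  qed
  have uS: "u i \<in> S" if "i \<in> I" for i using net(2) that by blast
  have "\<forall>i\<in>I. (fst (u i), snd (u i)) \<in> gra A" using uS by (fastforce simp: S_def N_def)
  moreover have "bounded ((\<lambda>i. (fst (u i), snd (u i))) ` I)"
    unfolding bounded_iff
  proof (intro exI ballI)
    fix g assume "g \<in> (\<lambda>i. (fst (u i), snd (u i))) ` I"
    then have "g \<in> S" using uS by auto
    then have "norm (fst g) \<le> 2 * (norm x'' + 1)" "norm (snd g - x') \<le> 1"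
      by (auto simp: S_def N_def)
    then show "norm g \<le> 2 * (norm x'' + 1) + (norm x' + 1)"
      using norm_triangle_sub[of "snd g" x'] norm_Pair_le[of "fst g" "snd g"] by simp
  qed
  moreover have "limitin weak_star_topology (\<lambda>i. canon (fst (u i))) x'' (tails I le)"
  proof (rule limitin_weak_star, rule tendstoI)
    fix f and \<epsilon> :: real assume \<epsilon>: "\<epsilon> > 0"
    have "eventually (\<lambda>i. u i \<in> N {f} (\<epsilon> / 2)) (tails I le)" using \<epsilon> by (intro ev_net) auto
    then show "\<forall>\<^sub>F i in tails I le. dist (canon (fst (u i)) f) (x'' f) < \<epsilon>"
      by (rule eventually_mono) (use \<epsilon> in \<open>auto simp: N_def dist_real_def\<close>)
  qed
  moreover have "((\<lambda>i. snd (u i)) \<longlongrightarrow> x') (tails I le)"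
  proof (rule tendstoI)
    fix \<epsilon> :: real assume \<epsilon>: "\<epsilon> > 0"
    have "eventually (\<lambda>i. u i \<in> N {} (\<epsilon> / 2)) (tails I le)" using \<epsilon> by (intro ev_net) auto
    then show "\<forall>\<^sub>F i in tails I le. dist (snd (u i)) x' < \<epsilon>"
      by (rule eventually_mono) (use \<epsilon> in \<open>auto simp: N_def dist_norm\<close>)
  qed
  ultimately show "\<exists>(I :: (('a \<times> 'a dual) \<times> ('a \<times> 'a dual) set) set) le a a'.
      directed_set I le \<and> (\<forall>i\<in>I. (a i, a' i) \<in> gra A) \<and> bounded ((\<lambda>i. (a i, a' i)) ` I) \<and>
      limitin weak_star_topology (\<lambda>i. canon (a i)) x'' (tails I le) \<and> (a' \<longlongrightarrow> x') (tails I le)"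
    using net(1) by (intro exI[of _ I] exI[of _ le] exI[of _ "\<lambda>i. fst (u i)"] exI[of _ "\<lambda>i. snd (u i)"]) simp
qed

end

section \<open>Type (FP)\<close>

context monotone_linear_relation
begin

lemma energy_convex:
  assumes a: "(a, a') \<in> gra A" and b: "(b, b') \<in> gra A" and u: "0 \<le> u" "0 \<le> t" "u + t = 1"
  shows "(u *\<^sub>R a' + t *\<^sub>R b') (u *\<^sub>R a + t *\<^sub>R b) \<le> u * a' a + t * b' b"
proof -
  have t: "t = 1 - u" using u by simp
  have "u * a' a + t * b' b - (u *\<^sub>R a' + t *\<^sub>R b') (u *\<^sub>R a + t *\<^sub>R b) = u * t * (a' - b') (a - b)"
    unfolding t by (simp add: blinfun.add_left blinfun.add_right blinfun.diff_left blinfun.diff_right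
        blinfun.scaleR_left blinfun.scaleR_right algebra_simps)
  moreover have "0 \<le> u * t * (a' - b') (a - b)"
    using u(1,2) nonneg[OF diff_mem[OF a b]] by simp
  ultimately show ?thesis by linarith
qed

text \<open>Suppose the pairing is at least \<open>m > 0\<close> on the part of the graph over \<open>W\<close>. Then the convex function
\<open>a' a - x' a\<close> on the graph and the affine function \<open>v x - x' x + m\<close> on \<open>W\<close> are separated by a linear
functional \<open>w\<close> of the dual variables \<open>a'\<close> and \<open>v\<close>; taking \<open>v = x'\<close> in the separation shows that (NI) fails at
\<open>(- w, x')\<close>. The set \<open>S\<close> below is the epigraph of the corresponding infimal convolution in the
variable \<open>v - a'\<close>, and the ball around \<open>a0'\<close> makes it absorbing and \<open>w\<close> bounded.\<close>

lemma type_NI_imp_near_solution: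
  fixes x :: 'a and x' :: "'a dual"
  assumes NI: "type_NI A" and W: "convex W" "x' \<in> W"
    and a0: "(a0, a0') \<in> gra A" and \<eta>: "\<eta> > 0" "ball a0' \<eta> \<subseteq> W" and m: "m > 0"
  shows "\<exists>a a'. (a, a') \<in> gra A \<and> a' \<in> W \<and> (a' - x') (a - x) < m"
proof (rule ccontr)
  assume "\<not> ?thesis"
  then have ge: "m \<le> (a' - x') (a - x)" if "(a, a') \<in> gra A" "a' \<in> W" for a a'
    using that by (force simp: not_less)
  define S where "S = {(u, s). \<exists>a a' v. (a, a') \<in> gra A \<and> v \<in> W \<and> u = v - a' \<and>
    a' a - x' a - v x + x' x - m \<le> s}"
  have SI: "(v - a', a' a - x' a - v x + x' x - m) \<in> S" if "(a, a') \<in> gra A" "v \<in> W" for a a' v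
    using that unfolding S_def by blast
  have "convex S"
  proof (rule convexI)
    fix y z and u t :: real assume "y \<in> S" "z \<in> S" and ut: "0 \<le> u" "0 \<le> t" "u + t = 1"
    then obtain a a' v s b b' w s' where *: "y = (v - a', s)" "(a, a') \<in> gra A" "v \<in> W"
      "a' a - x' a - v x + x' x - m \<le> s" "z = (w - b', s')" "(b, b') \<in> gra A" "w \<in> W"
      "b' b - x' b - w x + x' x - m \<le> s'" unfolding S_def by blast
    have "(u *\<^sub>R a + t *\<^sub>R b, u *\<^sub>R a' + t *\<^sub>R b') \<in> gra A" using * by (intro add_mem scale_mem)
    moreover have "u *\<^sub>R v + t *\<^sub>R w \<in> W" using W(1) * ut by (intro convexD)
    moreover have "(u *\<^sub>R a' + t *\<^sub>R b') (u *\<^sub>R a + t *\<^sub>R b) - x' (u *\<^sub>R a + t *\<^sub>R b)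
        - (u *\<^sub>R v + t *\<^sub>R w) x + x' x - m \<le> u * s + t * s'"
    proof -
      have "u * (a' a - x' a - v x + x' x - m) + t * (b' b - x' b - w x + x' x - m) \<le> u * s + t * s'"
        using * ut by (intro add_mono mult_left_mono)
      moreover have "u * (x' x - m) + t * (x' x - m) = x' x - m"
        using ut(3) by (metis distrib_right mult_1)
      ultimately show ?thesis using energy_convex[OF *(2,6) ut]
        by (simp add: blinfun.add_left blinfun.add_right blinfun.scaleR_left blinfun.scaleR_right
            algebra_simps)
    qed
    moreover have "u *\<^sub>R y + t *\<^sub>R z =
        ((u *\<^sub>R v + t *\<^sub>R w) - (u *\<^sub>R a' + t *\<^sub>R b'), u * s + t * s')"
      unfolding *(1,5) by (simp add: algebra_simps)
    ultimately show "u *\<^sub>R y + t *\<^sub>R z \<in> S" unfolding S_def by auto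
  qed
  moreover have "\<exists>t>0. \<exists>s. (t *\<^sub>R u, s) \<in> S" for u
  proof -
    define t where "t = \<eta> / (norm u + 1)"
    have t: "t > 0" using \<eta>(1) by (simp add: t_def add_nonneg_pos)
    have "t * (norm u + 1) = \<eta>"
      using add_nonneg_pos[OF norm_ge_zero[of u] zero_less_one] by (simp add: t_def)
    then have "norm (t *\<^sub>R u) < \<eta>" using t by (simp add: distrib_left)
    then have "a0' + t *\<^sub>R u \<in> W" using \<eta>(2) by (auto simp: dist_norm)
    from SI[OF a0 this] show ?thesis using t by auto
  qed
  moreover have "r \<le> s" if r: "(u, r) \<in> {(0, 0)}" and s: "(u, s) \<in> S" for u r s
  proof -
    obtain a a' where a: "(a, a') \<in> gra A" "a' \<in> W" "a' a - x' a - a' x + x' x - m \<le> s"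
      using r s unfolding S_def by auto
    then show ?thesis using ge[OF a(1,2)] r by (simp add: blinfun.diff_left blinfun.diff_right)
  qed
  moreover have sub: "subspace {(0 :: 'a dual, 0 :: real)}"
    using subspace_single_0[where 'a = "'a dual \<times> real"] unfolding zero_prod_def .
  ultimately obtain L where L: "linear L" "\<And>u s. (u, s) \<in> S \<Longrightarrow> L u \<le> s"
    using hahn_banach_epigraph[OF sub, of S] by metis
  define k where "k = \<bar>a0' a0 - x' a0 - a0' x + x' x - m\<bar> + \<eta> * norm x"
  have near: "L u \<le> k" if u: "norm u < \<eta>" for u
  proof -
    have "a0' + u \<in> W" using \<eta>(2) u by (auto simp: dist_norm)
    from L(2)[OF SI[OF a0 this]]
    have "L u \<le> a0' a0 - x' a0 - (a0' + u) x + x' x - m" by simp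
    moreover have "\<bar>u x\<bar> \<le> \<eta> * norm x"
      using norm_blinfun[of u x] mult_right_mono[of "norm u" \<eta> "norm x"] u by simp
    ultimately show ?thesis unfolding k_def by (simp add: blinfun.add_left)
  qed
  have "L u \<le> (2 * k / \<eta>) * norm u" for u
  proof (cases "u = 0")
    case True
    then show ?thesis using linear_0[OF L(1)] by simp
  next
    case False
    define t where "t = \<eta> / (2 * norm u)"
    have "t > 0" using False \<eta>(1) by (simp add: t_def)
    have "norm (t *\<^sub>R u) < \<eta>" using False \<eta>(1) by (simp add: t_def)
    then have "t * L u \<le> k" using near[of "t *\<^sub>R u"] by (simp add: linear_scale[OF L(1)])
    then have "L u \<le> k / t" using \<open>t > 0\<close> by (simp add: field_simps)
    then show ?thesis using False by (simp add: t_def mult_ac)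
  qed
  then obtain w :: "'a bidual" where w: "blinfun_apply w = L"
    using linear_bounded_above_imp_blinfun[OF L(1)] by blast
  have "x' a + (- w) a' - a' a \<le> (- w) x' - m" if a: "(a, a') \<in> gra A" for a a'
    using L(2)[OF SI[OF a W(2)]] unfolding w[symmetric]
    by (simp add: blinfun.diff_right blinfun.minus_left)
  then have "(SUP (a, a') \<in> gra A. ereal (x' a + (- w) a' - a' a)) \<le> ereal ((- w) x' - m)"
    by (intro SUP_least) auto
  moreover have "ereal ((- w) x') \<le> (SUP (a, a') \<in> gra A. ereal (x' a + (- w) a' - a' a))"
    using NI unfolding type_NI_def by blast
  ultimately have "ereal ((- w) x') \<le> ereal ((- w) x' - m)" by (rule order_trans[rotated])
  then show False using m by simp
qed

text \<open>The set \<open>W\<close> is a bounded convex neighbourhood of the segment from \<open>x'\<close> to \<open>a0'\<close> that stays at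
distance \<open>\<eta>\<close> from the complement of \<open>V\<close>. Take a point \<open>(b, b')\<close> of the graph over \<open>W\<close> where the pairing with
\<open>(x, x')\<close> is almost zero, and move from it towards an arbitrary point \<open>(a, a')\<close> of the graph, by a
fraction \<open>t\<close> that depends only on \<open>a'\<close> and the size of \<open>W\<close>. The new point is still over \<open>V\<close>, so its
pairing is nonnegative; by convexity the pairing at \<open>(a, a')\<close> cannot be negative. Hence
\<open>(x, x')\<close> is related to the whole graph.\<close>

lemma type_NI_imp_type_FP:
  assumes max: "maximally_monotone A" and NI: "type_NI A"
  shows "type_FP A"
  unfolding type_FP_def maximally_monotone_wrt_iff
proof (intro allI impI conjI ballI)
  fix V assume "open V \<and> convex V \<and> V \<inter> ran A \<noteq> {}"
  then have V: "open V" "convex V" "V \<inter> ran A \<noteq> {}" by blast+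
  show "monotone_wrt A UNIV V" using mono unfolding monotone_wrt_def by blast
  fix x x' assume x': "x' \<in> V"
    and "\<forall>a\<in>UNIV. \<forall>a'\<in>V. (a, a') \<in> gra A \<longrightarrow> 0 \<le> (a' - x') (a - x)"
  then have rel: "\<And>a a'. (a, a') \<in> gra A \<Longrightarrow> a' \<in> V \<Longrightarrow> 0 \<le> (a' - x') (a - x)" by blast
  obtain a0 a0' where a0: "(a0, a0') \<in> gra A" "a0' \<in> V" using V(3) by (auto simp: ran_def mem_gra)
  obtain r1 where r1: "r1 > 0" "ball x' r1 \<subseteq> V" using V(1) x' openE by blast
  obtain r2 where r2: "r2 > 0" "ball a0' r2 \<subseteq> V" using V(1) a0(2) openE by blast
  define \<eta> where "\<eta> = min r1 r2 / 2"
  have \<eta>: "\<eta> > 0" using r1 r2 by (simp add: \<eta>_def)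
  define W where "W = (\<Union>p\<in>closed_segment x' a0'. \<Union>e\<in>ball 0 \<eta>. {p + e})"
  have W_V: "v + e \<in> V" if v: "v \<in> W" and e: "norm e < \<eta>" for v e
  proof -
    obtain s d where s: "0 \<le> s" "s \<le> 1" "norm d < \<eta>" "v = (1 - s) *\<^sub>R x' + s *\<^sub>R a0' + d"
      using v by (auto simp: W_def in_segment)
    have "norm (d + e) < 2 * \<eta>" using norm_triangle_ineq[of d e] s(3) e by linarith
    moreover have "p + w \<in> ball p r \<longleftrightarrow> norm w < r" for p w :: "'a dual" and r
      by (simp add: dist_norm)
    ultimately have "x' + (d + e) \<in> ball x' r1" "a0' + (d + e) \<in> ball a0' r2"
      by (simp_all only: \<eta>_def)
    then have "x' + (d + e) \<in> V" "a0' + (d + e) \<in> V" using r1(2) r2(2) by blast+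
    then have "(1 - s) *\<^sub>R (x' + (d + e)) + s *\<^sub>R (a0' + (d + e)) \<in> V"
      using V(2) s by (intro convexD_alt)
    moreover have "(1 - s) *\<^sub>R (x' + (d + e)) + s *\<^sub>R (a0' + (d + e)) = v + e"
      unfolding s(4) by (simp add: algebra_simps)
    ultimately show ?thesis by simp
  qed
  have "convex W" unfolding W_def by (intro convex_sums) auto
  have WI: "p + e \<in> W" if "p \<in> closed_segment x' a0'" "norm e < \<eta>" for p e
    unfolding W_def using that by (intro UN_I[of p] UN_I[of e]) auto
  have "x' + 0 \<in> W" using \<eta> by (intro WI) auto
  then have "x' \<in> W" by simp
  have ballW: "ball a0' \<eta> \<subseteq> W"
  proof
    fix v assume "v \<in> ball a0' \<eta>"
    then have "a0' + (v - a0') \<in> W"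
      by (intro WI) (auto simp: dist_norm norm_minus_commute)
    then show "v \<in> W" by simp
  qed
  have "bounded W" unfolding W_def by (intro bounded_sums bounded_closed_segment bounded_ball)
  then obtain R where R: "\<And>v. v \<in> W \<Longrightarrow> norm v \<le> R" unfolding bounded_iff by blast
  have R0: "R \<ge> 0" using R[OF \<open>x' \<in> W\<close>] norm_ge_zero order_trans by blast
  have "0 \<le> (a' - x') (a - x)" if a: "(a, a') \<in> gra A" for a a'
  proof -
    \<comment> \<open>Small enough for \<open>t * norm (a' - b') < \<eta>\<close> whenever \<open>b' \<in> W\<close>, but independent of \<open>b'\<close>.\<close>
    define t where "t = \<eta> / (\<eta> + (R + norm a' + 1))"
    have "R + norm a' + 1 > 0" using R0 norm_ge_zero[of a'] by linarith
    then have pos: "\<eta> + (R + norm a' + 1) > 0" and t: "0 < t" "t < 1"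
      using \<eta> by (simp_all add: t_def)
    have "0 \<le> t * (a' - x') (a - x) + m" if m: "m > 0" for m
    proof -
      obtain b b' where b: "(b, b') \<in> gra A" "b' \<in> W" "(b' - x') (b - x) < m"
        using type_NI_imp_near_solution[OF NI \<open>convex W\<close> \<open>x' \<in> W\<close> a0(1) \<eta> ballW m] by blast
      have "norm (t *\<^sub>R (a' - b')) < \<eta>"
      proof -
        have "norm (a' - b') \<le> norm a' + R" using norm_triangle_ineq4[of a' b'] R[OF b(2)] by linarith
        then have "t * norm (a' - b') \<le> t * (norm a' + R)" using t by (intro mult_left_mono) auto
        also have "\<dots> < t * (\<eta> + (R + norm a' + 1))" using t \<eta> by (intro mult_strict_left_mono) auto
        also have "\<dots> = \<eta>" using pos by (simp add: t_def)
        finally show ?thesis using t by simp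
      qed
      then have "b' + t *\<^sub>R (a' - b') \<in> V" using b(2) by (rule W_V[rotated])
      moreover have "(b + t *\<^sub>R (a - b), b' + t *\<^sub>R (a' - b')) \<in> gra A"
        using a b(1) by (intro add_mem scale_mem diff_mem)
      ultimately have "0 \<le> (b' + t *\<^sub>R (a' - b') - x') (b + t *\<^sub>R (a - b) - x)"
        by (intro rel)
      also have "\<dots> = (1 - t) * (b' - x') (b - x) + t * (a' - x') (a - x) - t * (1 - t) * (a' - b') (a - b)"
        by (simp add: blinfun.add_left blinfun.add_right blinfun.diff_left blinfun.diff_right
            blinfun.scaleR_left blinfun.scaleR_right algebra_simps)
      also have "\<dots> \<le> m + t * (a' - x') (a - x)"
      proof -
        have "0 \<le> t * (1 - t) * (a' - b') (a - b)" using t nonneg[OF diff_mem[OF a b(1)]] by simp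
        moreover have "(1 - t) * (b' - x') (b - x) \<le> 1 * m"
          using t b(3) rel[OF b(1)] W_V[OF b(2), of 0] \<eta> by (intro mult_mono) auto
        ultimately show ?thesis by linarith
      qed
      finally show ?thesis by simp
    qed
    then have "0 \<le> t * (a' - x') (a - x)" by (rule field_le_epsilon)
    then show ?thesis using t(1) by (simp add: zero_le_mult_iff)
  qed
  then show "(x, x') \<in> gra A" using max unfolding maximally_monotone_wrt_iff by blast
qed

section \<open>The skew part\<close>

lemma mem_gra_skew_part:
  "(b, k) \<in> gra (skew_part A) \<longleftrightarrow>
    (\<exists>b' c. (b, b') \<in> gra A \<and> (canon b, c) \<in> gra (adjoint_rel A) \<and> k = (1/2) *\<^sub>R b' - (1/2) *\<^sub>R c)"
  by (auto simp: mem_gra skew_part_def)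

lemma skew_part_skew:
  assumes "(b, k) \<in> gra (skew_part A)"
  shows "k b = 0"
proof -
  obtain b' c where b: "(b, b') \<in> gra A" "(canon b, c) \<in> gra (adjoint_rel A)"
    "k = (1/2) *\<^sub>R b' - (1/2) *\<^sub>R c" using assms unfolding mem_gra_skew_part by blast
  then have "c b = canon b b'" unfolding mem_gra_adjoint by blast
  then show ?thesis using b(3) by (simp add: blinfun.diff_left blinfun.scaleR_left)
qed

lemma linear_relation_skew_part: "linear_relation (skew_part A)"
proof -
  have canon_add: "canon (x + y) = canon x + canon y" for x y :: 'a
    by (rule blinfun_eqI) (simp add: blinfun.add_left blinfun.add_right)
  have canon_scale: "canon (t *\<^sub>R x) = t *\<^sub>R canon x" for t and x :: 'a
    by (rule blinfun_eqI) (simp add: blinfun.scaleR_left blinfun.scaleR_right)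
  have "subspace (gra (skew_part A))"
  proof (rule subspaceI)
    show "0 \<in> gra (skew_part A)"
      unfolding zero_prod_def mem_gra_skew_part
      using zero_mem subspace_0[OF subspace_gra_adjoint[of A]]
      by (intro exI[of _ 0]) (simp add: zero_prod_def)
  next
    fix p q assume "p \<in> gra (skew_part A)" "q \<in> gra (skew_part A)"
    then obtain x x' x'' y y' y'' where
      x: "p = (x, (1/2) *\<^sub>R x' - (1/2) *\<^sub>R x'')" "(x, x') \<in> gra A" "(canon x, x'') \<in> gra (adjoint_rel A)" and
      y: "q = (y, (1/2) *\<^sub>R y' - (1/2) *\<^sub>R y'')" "(y, y') \<in> gra A" "(canon y, y'') \<in> gra (adjoint_rel A)"
      by (metis mem_gra_skew_part surj_pair)
    have "(canon x, x'') + (canon y, y'') \<in> gra (adjoint_rel A)"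
      using x y by (intro subspace_add subspace_gra_adjoint)
    then show "p + q \<in> gra (skew_part A)"
      unfolding x(1) y(1) plus_prod_def fst_conv snd_conv mem_gra_skew_part
      using add_mem[OF x(2) y(2)]
      by (intro exI[of _ "x' + y'"] exI[of _ "x'' + y''"]) (simp add: canon_add algebra_simps)
  next
    fix t p assume "p \<in> gra (skew_part A)"
    then obtain x x' x'' where
      x: "p = (x, (1/2) *\<^sub>R x' - (1/2) *\<^sub>R x'')" "(x, x') \<in> gra A" "(canon x, x'') \<in> gra (adjoint_rel A)"
      by (metis mem_gra_skew_part surj_pair)
    have "t *\<^sub>R (canon x, x'') \<in> gra (adjoint_rel A)"
      using x by (intro subspace_scale subspace_gra_adjoint)
    then show "t *\<^sub>R p \<in> gra (skew_part A)"
      unfolding x(1) scaleR_prod_def fst_conv snd_conv mem_gra_skew_part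
      using scale_mem[OF x(2), of t]
      by (intro exI[of _ "t *\<^sub>R x'"] exI[of _ "t *\<^sub>R x''"]) (simp add: canon_scale algebra_simps)
  qed
  then show ?thesis by (simp add: linear_relation_def)
qed

lemma monotone_linear_relation_skew_part: "monotone_linear_relation (skew_part A)"
proof
  show "linear_relation (skew_part A)" by (rule linear_relation_skew_part)
  have "0 \<le> (x' - y') (x - y)" if "(x, x') \<in> gra (skew_part A)" "(y, y') \<in> gra (skew_part A)" for x x' y y'
  proof -
    have "(x, x') - (y, y') \<in> gra (skew_part A)"
      using that linear_relation_skew_part unfolding linear_relation_def by (intro subspace_diff)
    then show ?thesis using skew_part_skew by simp
  qed
  then show "monotone_op (skew_part A)" unfolding monotone_wrt_def by blast
qed

end

context closed_domain_relation
begin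

text \<open>Elements of the domain annihilate \<open>A 0\<close>, so the domain of the adjoint contains their canonical images.\<close>

lemma adjoint_of_canon:
  assumes A0: "A 0 = annihilator (dom A)" and a: "a \<in> dom A"
  obtains c where "(canon a, c) \<in> gra (adjoint_rel A)"
proof -
  have "canon a f = 0" if "f \<in> A 0" for f using a that A0 by (auto simp: annihilator_def)
  then show thesis using that by (rule adjoint_domain)
qed

lemma dom_skew_part:
  assumes "A 0 = annihilator (dom A)"
  shows "dom (skew_part A) = dom A"
proof (intro equalityI subsetI)
  fix a assume a: "a \<in> dom A"
  obtain a' where "(a, a') \<in> gra A" using a by (rule domE)
  moreover obtain c where "(canon a, c) \<in> gra (adjoint_rel A)"
    by (rule adjoint_of_canon[OF assms a])
  ultimately have "(a, (1/2) *\<^sub>R a' - (1/2) *\<^sub>R c) \<in> gra (skew_part A)"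
    unfolding mem_gra_skew_part by blast
  then show "a \<in> dom (skew_part A)" by (rule domI)
next
  fix a assume "a \<in> dom (skew_part A)"
  then obtain k where "(a, k) \<in> gra (skew_part A)" by (rule domE)
  then obtain b' where "(a, b') \<in> gra A" unfolding mem_gra_skew_part by blast
  then show "a \<in> dom A" by (rule domI)
qed

lemma skew_part_zero:
  assumes A0: "A 0 = annihilator (dom A)"
  shows "skew_part A 0 = annihilator (dom A)"
proof (intro equalityI subsetI)
  fix f assume "f \<in> skew_part A 0"
  then show "f \<in> annihilator (dom A)"
    using A0 by (auto simp: skew_part_def adjoint_rel_zero annihilator_def blinfun.diff_left blinfun.scaleR_left)
next
  fix f assume f: "f \<in> annihilator (dom A)"
  then have "2 *\<^sub>R f \<in> A 0" "0 \<in> adjoint_rel A (canon 0)"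
    using A0 by (auto simp: adjoint_rel_zero annihilator_def blinfun.scaleR_left)
  then have "(1/2) *\<^sub>R (2 *\<^sub>R f) - (1/2) *\<^sub>R 0 \<in> skew_part A 0" unfolding skew_part_def by blast
  then show "f \<in> skew_part A 0" by simp
qed

text \<open>The graph of the skew part is closed because the skew part is maximally monotone: its value at \<open>0\<close> and its domain
are those of \<open>A\<close>.\<close>

lemma closed_domain_relation_skew_part:
  assumes A0: "A 0 = annihilator (dom A)"
  shows "closed_domain_relation (skew_part A)"
proof -
  interpret skew: monotone_linear_relation "skew_part A"
    by (rule monotone_linear_relation_skew_part)
  have "maximally_monotone (skew_part A)"
    by (rule skew.image_zero_imp_maximal)
      (simp_all add: dom_skew_part[OF A0] skew_part_zero[OF A0] closed_dom)
  then show ?thesis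
    by unfold_locales
      (simp_all add: maximally_monotone_imp_closed_gra dom_skew_part[OF A0] closed_dom)
qed

text \<open>On the domain, \<open>z' - y'\<close> is the functional \<open>a \<mapsto> z (S a)\<close> with the symmetric part \<open>S = (A + A*) / 2\<close>.
Because \<open>(S a) d\<close> is the energy product of the points over \<open>a\<close> and \<open>d\<close>, the functional is bounded by
the root of the energy, and the approximate Riesz representation makes it \<open>S b\<close> up to a small error
\<open>e\<close>. Up to the error, \<open>z (z' - y')\<close> is then the energy of \<open>b\<close>, which is nonnegative; and \<open>z y'\<close> is the energy of \<open>A*\<close>
at \<open>z - b\<close>, since subtracting \<open>b\<close> removes the symmetric contribution and leaves the
skew one unchanged.\<close>

lemma adjoint_skew_part_split:
  fixes z :: "'a bidual"
  assumes A0: "A 0 = annihilator (dom A)" and z: "(z, z') \<in> gra (adjoint_rel A)"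
    and y: "(z, y') \<in> gra (adjoint_rel (skew_part A))"
  shows "z y' \<le> z z'" and "bidual_monotone (adjoint_rel A) \<Longrightarrow> 0 \<le> z y'"
proof -
  have z0: "z f = 0" if "f \<in> annihilator (dom A)" for f
  proof -
    have "(0, f) \<in> gra A" using that A0 by (simp add: mem_gra)
    then have "z' 0 = z f" using z unfolding mem_gra_adjoint by blast
    then show ?thesis by (simp add: blinfun.zero_right)
  qed
  \<comment> \<open>The vector on the right is \<open>S a\<close>.\<close>
  have split: "z' a - y' a = z ((1/2) *\<^sub>R (a' + c))"
    if a: "(a, a') \<in> gra A" and c: "(canon a, c) \<in> gra (adjoint_rel A)" for a a' c
  proof -
    have "(a, (1/2) *\<^sub>R a' - (1/2) *\<^sub>R c) \<in> gra (skew_part A)"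
      using a c unfolding mem_gra_skew_part by blast
    then have "y' a = z ((1/2) *\<^sub>R a' - (1/2) *\<^sub>R c)" using y unfolding mem_gra_adjoint by blast
    moreover have "z' a = z a'" using z a unfolding mem_gra_adjoint by blast
    ultimately show ?thesis
      by (simp add: blinfun.diff_right blinfun.add_right blinfun.scaleR_right)
  qed
  obtain C where C: "C \<ge> 0" "\<And>a a'. (a, a') \<in> gra A \<Longrightarrow> a' a \<le> C * (norm a)\<^sup>2"
    using energy_bound by blast
  define L where "L g = (z' - y') (fst g)" for g :: "'a \<times> 'a dual"
  have "linear L" by (auto simp: L_def linear_iff blinfun.add_right blinfun.scaleR_right)
  moreover have "(L g)\<^sup>2 \<le> ((norm z)\<^sup>2 * C) * energy g g" if g: "g \<in> gra A" for g
  proof -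
    obtain a a' where a: "g = (a, a')" "(a, a') \<in> gra A" using g by (cases g) auto
    obtain c where c: "(canon a, c) \<in> gra (adjoint_rel A)"
      by (rule adjoint_of_canon[OF A0 domI[OF a(2)]])
    have "\<bar>((1/2) *\<^sub>R (a' + c)) d\<bar> \<le> sqrt (C * energy g g) * norm d" if d: "d \<in> dom A" for d
    proof -
      obtain d' where d': "(d, d') \<in> gra A" using d by (rule domE)
      have "c d = d' a" using c d' unfolding mem_gra_adjoint by fastforce
      then have eq: "((1/2) *\<^sub>R (a' + c)) d = energy g (d, d')"
        by (simp add: a(1) energy_def blinfun.add_left blinfun.scaleR_left)
      have "(energy g (d, d'))\<^sup>2 \<le> energy (d, d') (d, d') * energy g g"
        using g d' by (rule energy.cauchy_schwarz)
      also have "\<dots> \<le> (C * (norm d)\<^sup>2) * energy g g"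
        using C(2)[OF d'] energy.nonneg[OF g] by (intro mult_right_mono) (auto simp: energy_def)
      finally have "sqrt ((energy g (d, d'))\<^sup>2) \<le> sqrt (C * energy g g * (norm d)\<^sup>2)"
        by (intro real_sqrt_le_mono) (simp add: mult_ac)
      then show ?thesis unfolding eq by (simp add: real_sqrt_mult)
    qed
    then have "\<bar>z ((1/2) *\<^sub>R (a' + c))\<bar> \<le> norm z * sqrt (C * energy g g)"
      using C(1) energy.nonneg[OF g] by (intro biannihilator_bound[OF subspace_dom z0]) auto
    then have "\<bar>L g\<bar> \<le> norm z * sqrt (C * energy g g)"
      using split[OF a(2) c] by (simp add: L_def a(1) blinfun.diff_left)
    then have "\<bar>L g\<bar>\<^sup>2 \<le> (norm z * sqrt (C * energy g g))\<^sup>2" by (intro power_mono) auto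
    then show ?thesis using C(1) energy.nonneg[OF g] by (simp add: power_mult_distrib mult_ac)
  qed
  moreover have "0 \<le> (norm z)\<^sup>2 * C" using C(1) by simp
  ultimately obtain K where K: "K \<ge> 0" "\<And>\<epsilon>. 0 < \<epsilon> \<Longrightarrow> \<epsilon> \<le> 1 \<Longrightarrow>
    \<exists>b b' e. (b, b') \<in> gra A \<and> norm e \<le> \<epsilon> * K \<and> \<bar>blinfun_apply e b\<bar> \<le> \<epsilon> * K \<and>
      (\<forall>a a'. (a, a') \<in> gra A \<longrightarrow> L (a, a') = (a' b + b' a) / 2 + blinfun_apply e a)"
    using approximate_representation by blast
  have approx: "z y' - z z' \<le> (norm z * K + K) * \<epsilon> \<and>
      (bidual_monotone (adjoint_rel A) \<longrightarrow> - z y' \<le> (norm z * K + K) * \<epsilon>)" if \<epsilon>: "0 < \<epsilon>" "\<epsilon> \<le> 1" for \<epsilon>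
  proof -
    obtain b b' e where b: "(b, b') \<in> gra A" "norm e \<le> \<epsilon> * K" "\<bar>blinfun_apply e b\<bar> \<le> \<epsilon> * K"
      "\<And>a a'. (a, a') \<in> gra A \<Longrightarrow> L (a, a') = (a' b + b' a) / 2 + blinfun_apply e a"
      using K(2)[OF \<epsilon>] by blast
    obtain c where c: "(canon b, c) \<in> gra (adjoint_rel A)"
      by (rule adjoint_of_canon[OF A0 domI[OF b(1)]])
    have cb: "c a = a' b" if "(a, a') \<in> gra A" for a a'
      using c that unfolding mem_gra_adjoint by fastforce
    define s where "s = (1/2) *\<^sub>R (b' + c)"
    have "(z' - y' - e - s) a = 0" if a: "a \<in> dom A" for a
    proof -
      obtain a' where a': "(a, a') \<in> gra A" using a by (rule domE)
      show ?thesis using b(4)[OF a'] cb[OF a']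
        by (simp add: L_def s_def blinfun.diff_left blinfun.add_left blinfun.scaleR_left)
    qed
    then have "z (z' - y' - e - s) = 0" by (intro z0) (simp add: annihilator_def)
    then have zs: "z z' - z y' = z e + z s" by (simp add: blinfun.diff_right)
    \<comment> \<open>Evaluate the representation at \<open>b\<close> itself.\<close>
    have bs: "z s = b' b + e b"
      using b(4)[OF b(1)] split[OF b(1) c] by (simp add: s_def L_def blinfun.diff_left)
    have "\<bar>z e\<bar> \<le> norm z * norm e" using norm_blinfun[of z e] by simp
    also have "\<dots> \<le> norm z * (\<epsilon> * K)" using b(2) by (intro mult_left_mono) auto
    finally have err: "\<bar>z e\<bar> + \<bar>e b\<bar> \<le> (norm z * K + K) * \<epsilon>"
      using b(3) by (simp add: algebra_simps)
    have "z y' - z z' \<le> (norm z * K + K) * \<epsilon>" using zs bs err nonneg[OF b(1)] by linarith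
    moreover have "- z y' \<le> (norm z * K + K) * \<epsilon>" if "bidual_monotone (adjoint_rel A)"
    proof -
      have "(z, z') - (canon b, c) \<in> gra (adjoint_rel A)"
        using z c by (intro subspace_diff subspace_gra_adjoint)
      then have "0 \<le> (z - canon b) (z' - c)"
        using that unfolding bidual_monotone_adjoint_iff by simp
      also have "\<dots> = z z' - z c - z' b + c b"
        by (simp add: blinfun.diff_left blinfun.diff_right)
      also have "\<dots> = z y' + z e - e b"
      proof -
        have "z' b = z b'" using z b(1) unfolding mem_gra_adjoint by blast
        moreover have "2 * z s = z b' + z c" by (simp add: s_def blinfun.add_right blinfun.scaleR_right)
        ultimately show ?thesis using zs bs cb[OF b(1)] by linarith
      qed
      finally show ?thesis using err by linarith
    qed
    ultimately show ?thesis by blast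
  qed
  have "z y' - z z' \<le> 0"
    by (rule le_sqrt_error_imp_le_zero[where a = "norm z * K + K" and b = 0 and c = 0]) (use approx in simp)
  then show "z y' \<le> z z'" by simp
  show "0 \<le> z y'" if "bidual_monotone (adjoint_rel A)"
  proof -
    have "- z y' \<le> 0"
      by (rule le_sqrt_error_imp_le_zero[where a = "norm z * K + K" and b = 0 and c = 0]) (use approx that in simp)
    then show ?thesis by simp
  qed
qed

lemma adjoint_monotone_iff_skew_part:
  assumes A0: "A 0 = annihilator (dom A)"
  shows "bidual_monotone (adjoint_rel A) \<longleftrightarrow> bidual_monotone (adjoint_rel (skew_part A))"
proof -
  interpret skew: closed_domain_relation "skew_part A"
    by (rule closed_domain_relation_skew_part[OF A0])
  show ?thesis
  proof
    assume mon: "bidual_monotone (adjoint_rel A)"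
    show "bidual_monotone (adjoint_rel (skew_part A))"
      unfolding bidual_monotone_adjoint_iff
    proof (intro allI impI)
      fix z y' assume y: "(z, y') \<in> gra (adjoint_rel (skew_part A))"
      have "z f = 0" if "f \<in> A 0" for f
      proof -
        have "(0, f) \<in> gra (skew_part A)" using that A0 skew_part_zero[OF A0] by (simp add: mem_gra)
        then have "y' 0 = z f" using y unfolding mem_gra_adjoint by blast
        then show ?thesis by (simp add: blinfun.zero_right)
      qed
      then obtain z' where "(z, z') \<in> gra (adjoint_rel A)" by (rule adjoint_domain)
      then show "0 \<le> z y'" using y mon by (rule adjoint_skew_part_split(2)[OF A0])
    qed
  next
    assume mon: "bidual_monotone (adjoint_rel (skew_part A))"
    show "bidual_monotone (adjoint_rel A)"
      unfolding bidual_monotone_adjoint_iff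
    proof (intro allI impI)
      fix z z' assume z: "(z, z') \<in> gra (adjoint_rel A)"
      have "z f = 0" if "f \<in> skew_part A 0" for f
      proof -
        have "(0, f) \<in> gra A" using that A0 skew_part_zero[OF A0] by (simp add: mem_gra)
        then have "z' 0 = z f" using z unfolding mem_gra_adjoint by blast
        then show ?thesis by (simp add: blinfun.zero_right)
      qed
      then obtain y' where y: "(z, y') \<in> gra (adjoint_rel (skew_part A))" by (rule skew.adjoint_domain)
      then have "0 \<le> z y'" using mon unfolding bidual_monotone_adjoint_iff by blast
      then show "0 \<le> z z'" using adjoint_skew_part_split(1)[OF A0 z y] by simp
    qed
  qed
qed

section \<open>The equivalences\<close>

lemma type_D_iff: "maximally_monotone A \<and> type_D A \<longleftrightarrow> bidual_monotone (adjoint_rel A)"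
  using type_D_imp_type_NI type_NI_imp_adjoint_monotone adjoint_monotone_imp_type_D
    adjoint_monotone_imp_maximal by blast

lemma type_NI_iff: "maximally_monotone A \<and> type_NI A \<longleftrightarrow> bidual_monotone (adjoint_rel A)"
  using type_NI_imp_adjoint_monotone type_D_iff type_D_imp_type_NI by blast

lemma type_FP_iff: "maximally_monotone A \<and> type_FP A \<longleftrightarrow> bidual_monotone (adjoint_rel A)"
  using type_FP_imp_adjoint_monotone type_NI_iff type_NI_imp_type_FP by blast

lemma bidual_maximal_iff:
  "bidual_maximally_monotone (adjoint_rel A) \<longleftrightarrow> bidual_monotone (adjoint_rel A)"
  using adjoint_monotone_imp_bidual_maximal bidual_maximally_monotone_def by blast

end

theorem theorem5p10:
  fixes A :: "'a::banach \<Rightarrow> 'a dual set"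
  assumes "linear_relation A"
    and "monotone_op A"
    and "closed (gra A)"
    and "closed (dom A)"
  shows
    "((maximally_monotone A \<and> type_D A) \<longleftrightarrow> (maximally_monotone A \<and> type_NI A)) \<and>
     ((maximally_monotone A \<and> type_D A) \<longleftrightarrow> (maximally_monotone A \<and> type_FP A)) \<and>
     ((maximally_monotone A \<and> type_D A) \<longleftrightarrow> bidual_monotone (adjoint_rel A)) \<and>
     ((maximally_monotone A \<and> type_D A) \<longleftrightarrow> bidual_maximally_monotone (adjoint_rel A)) \<and>
     ((maximally_monotone A \<and> type_D A) \<longleftrightarrow>
        (maximally_monotone (skew_part A) \<and> type_D (skew_part A)) \<and>
        adjoint_rel A (canon 0) = A 0) \<and>
     ((maximally_monotone A \<and> type_D A) \<longleftrightarrow>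
        bidual_maximally_monotone (adjoint_rel (skew_part A)) \<and> adjoint_rel A (canon 0) = A 0) \<and>
     ((maximally_monotone A \<and> type_D A) \<longleftrightarrow>
        bidual_monotone (adjoint_rel (skew_part A)) \<and> adjoint_rel A (canon 0) = A 0)"
proof -
  interpret closed_domain_relation A
    using assms by unfold_locales
  have zero: "adjoint_rel A (canon 0) = A 0 \<longleftrightarrow> A 0 = annihilator (dom A)"
    by (auto simp: adjoint_rel_zero)
  have skew: "(maximally_monotone (skew_part A) \<and> type_D (skew_part A)
        \<longleftrightarrow> bidual_monotone (adjoint_rel A)) \<and>
      (bidual_maximally_monotone (adjoint_rel (skew_part A)) \<longleftrightarrow> bidual_monotone (adjoint_rel A)) \<and>
      (bidual_monotone (adjoint_rel (skew_part A)) \<longleftrightarrow> bidual_monotone (adjoint_rel A))"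
    if A0: "A 0 = annihilator (dom A)"
  proof -
    interpret skew: closed_domain_relation "skew_part A"
      by (rule closed_domain_relation_skew_part[OF A0])
    show ?thesis
      using skew.type_D_iff skew.bidual_maximal_iff adjoint_monotone_iff_skew_part[OF A0] by blast
  qed
  show ?thesis
    unfolding type_D_iff type_NI_iff type_FP_iff bidual_maximal_iff zero
    using skew adjoint_monotone_imp_image_zero by blast
qed

end
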